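(* For $n=0,1,2$, the group $G_n$ is connected and hence irreducible (in the topology induced from the ind-Zariski topology of $G$).
   Context: $R=\mathbb{C}\langle x,y\rangle$ is the free associative $\mathbb{C}$-algebra on $x,y$, and $G$ is the group of all $\mathbb{C}$-algebra automorphisms $\sigma$ of $R$ with $\sigma([x,y])=[x,y]$, viewed as a subset of $R\times R$ via $\sigma\mapsto(\sigma(x),\sigma(y))$. For $n\ge 1$, $\mathcal{C}_n$ is the quotient, by simultaneous conjugation by $\mathrm{PGL}_n(\mathbb{C})$, of the set of pairs $(X,Y)$ of complex $n\times n$ matrices with $\mathrm{rank}([X,Y]+I_n)=1$. $G$ acts on $\mathcal{C}_n$ by $\sigma\cdot(X,Y)=(\sigma^{-1}(X),\sigma^{-1}(Y))$, where $\tau(X),\tau(Y)$ are obtained by substituting $x=X$, $y=Y$ into $\tau(x),\tau(y)$. For $n\geq 1$, $G_n$ is the stabilizer in $G$ of the basepoint $(X_0,Y_0)\in\mathcal{C}_n$, $X_0=\sum_{i=1}^{n-1}E_{i+1,i}$, $Y_0=\sum_{i=1}^{n-1}(i-n)E_{i,i+1}$; and $G_0=G$. Topology: let $R^{(k)}$ be the space of elements of $R$ of degree $\le k$ and $G^{(k)}=G\cap(R^{(k)}\times R^{(k)})$, which is Zariski closed in $R^{(k)}\times R^{(k)}$. A subset $S\subseteq G$ is closed iff $S\cap G^{(k)}$ is Zariski closed in $G^{(k)}$ for all $k$. $G_n$ is a closed subgroup of $G$ with the subspace topology. *)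

theory Defs
  imports
    "HOL-Library.Poly_Mapping"
    "HOL-Algebra.Group_Action"
    "HOL-Analysis.Abstract_Topology"
    "Jordan_Normal_Form.DL_Rank"
begin

section \<open>The free associative algebra on two generators\<close>

datatype letter = Lx | Ly

datatype nc_word = Word (letters: "letter list")

text \<open>Concatenation of words is written additively because the product of
  \<^typ>\<open>'a \<Rightarrow>\<^sub>0 'b\<close> convolves along the addition of the type of exponents.\<close>

instantiation nc_word :: monoid_add
begin

definition zero_nc_word :: nc_word where
  "0 = Word []"

definition plus_nc_word :: "nc_word \<Rightarrow> nc_word \<Rightarrow> nc_word" where
  "u + v = Word (letters u @ letters v)"

instance
  by standard (auto simp: zero_nc_word_def plus_nc_word_def)

end

type_synonym free_alg = "nc_word \<Rightarrow>\<^sub>0 complex"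

definition scalar :: "complex \<Rightarrow> free_alg" where
  "scalar c = Poly_Mapping.single 0 c"

definition gen_x :: free_alg where
  "gen_x = Poly_Mapping.single (Word [Lx]) 1"

definition gen_y :: free_alg where
  "gen_y = Poly_Mapping.single (Word [Ly]) 1"

definition commutator :: "'a::ring \<Rightarrow> 'a \<Rightarrow> 'a" where
  "commutator a b = a * b - b * a"

definition free_alg_upto :: "nat \<Rightarrow> free_alg set" where
  "free_alg_upto k = {p. \<forall>w \<in> Poly_Mapping.keys p. length (letters w) \<le> k}"

definition alg_automorphism :: "(free_alg \<Rightarrow> free_alg) \<Rightarrow> bool" where
  "alg_automorphism \<sigma> \<longleftrightarrow>
     bij \<sigma> \<and>
     (\<forall>p q. \<sigma> (p + q) = \<sigma> p + \<sigma> q) \<and>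
     (\<forall>p q. \<sigma> (p * q) = \<sigma> p * \<sigma> q) \<and>
     (\<forall>c p. \<sigma> (scalar c * p) = scalar c * \<sigma> p) \<and>
     \<sigma> 1 = 1"

definition Aut_comm :: "(free_alg \<Rightarrow> free_alg) monoid" where
  "Aut_comm =
     \<lparr>carrier = {\<sigma>. alg_automorphism \<sigma> \<and>
                    \<sigma> (commutator gen_x gen_y) = commutator gen_x gen_y},
      mult = (\<circ>),
      one = id\<rparr>"

lemma group_Aut_comm: "group Aut_comm"
proof (rule groupI)
  fix \<sigma> \<tau> assume "\<sigma> \<in> carrier Aut_comm" "\<tau> \<in> carrier Aut_comm"
  then have h: "alg_automorphism \<sigma>" "alg_automorphism \<tau>"
    and c: "(\<sigma> \<circ> \<tau>) (commutator gen_x gen_y) = commutator gen_x gen_y"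
    by (auto simp: Aut_comm_def)
  have lin: "\<sigma> (scalar a * p) = scalar a * \<sigma> p" "\<tau> (scalar a * p) = scalar a * \<tau> p" for a p
    using h unfolding alg_automorphism_def by blast+
  have "(\<sigma> \<circ> \<tau>) (scalar a * p) = scalar a * (\<sigma> \<circ> \<tau>) p" for a p
    by (simp only: o_apply lin)
  moreover have "bij (\<sigma> \<circ> \<tau>)"
    using h by (auto simp: alg_automorphism_def intro: bij_comp)
  ultimately have "alg_automorphism (\<sigma> \<circ> \<tau>)"
    using h unfolding alg_automorphism_def by simp
  with c show "\<sigma> \<otimes>\<^bsub>Aut_comm\<^esub> \<tau> \<in> carrier Aut_comm"
    by (simp add: Aut_comm_def)
next
  show "\<one>\<^bsub>Aut_comm\<^esub> \<in> carrier Aut_comm"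
    by (auto simp: Aut_comm_def alg_automorphism_def)
next
  fix \<sigma> assume "\<sigma> \<in> carrier Aut_comm"
  then have b: "bij \<sigma>" and h: "alg_automorphism \<sigma>"
    and c: "\<sigma> (commutator gen_x gen_y) = commutator gen_x gen_y"
    by (auto simp: Aut_comm_def alg_automorphism_def)
  define \<tau> where "\<tau> = inv_into UNIV \<sigma>"
  have st: "\<sigma> (\<tau> p) = p" and ts: "\<tau> (\<sigma> p) = p" for p
    using b by (auto simp: \<tau>_def bij_def surj_f_inv_f)
  have eqI: "\<tau> p = q" if "p = \<sigma> q" for p q
    using that ts by simp
  have "bij \<tau>"
    unfolding \<tau>_def using b by (rule bij_imp_bij_inv)
  then have "alg_automorphism \<tau>"
    using h unfolding alg_automorphism_def by (auto intro!: eqI simp: st)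
  moreover have "\<tau> (commutator gen_x gen_y) = commutator gen_x gen_y"
    using c by (intro eqI) simp
  ultimately have "\<tau> \<in> carrier Aut_comm"
    by (simp add: Aut_comm_def)
  moreover have "\<tau> \<otimes>\<^bsub>Aut_comm\<^esub> \<sigma> = \<one>\<^bsub>Aut_comm\<^esub>"
    by (auto simp: Aut_comm_def ts)
  ultimately show "\<exists>\<tau> \<in> carrier Aut_comm. \<tau> \<otimes>\<^bsub>Aut_comm\<^esub> \<sigma> = \<one>\<^bsub>Aut_comm\<^esub>"
    by blast
qed (auto simp: Aut_comm_def)

section \<open>Calogero--Moser spaces and the stabilizers of the base points\<close>

type_synonym mat_pair = "complex mat \<times> complex mat"

definition CM_pairs :: "nat \<Rightarrow> mat_pair set" where
  "CM_pairs n =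
     {(X, Y). X \<in> carrier_mat n n \<and> Y \<in> carrier_mat n n \<and>
              vec_space.rank n ((X * Y - Y * X) + 1\<^sub>m n) = 1}"

text \<open>Scalar matrices act trivially by conjugation, so the orbits of
  \<open>PGL\<^sub>n\<close> are those of \<open>GL\<^sub>n\<close>; the matrices \<open>P\<close>, \<open>Q\<close> below are mutually inverse.\<close>

definition CM_rel :: "nat \<Rightarrow> (mat_pair \<times> mat_pair) set" where
  "CM_rel n =
     {((X, Y), (X', Y')). (X, Y) \<in> CM_pairs n \<and> (X', Y') \<in> CM_pairs n \<and>
        (\<exists>P Q. similar_mat_wit X' X P Q \<and> similar_mat_wit Y' Y P Q)}"

definition CM_space :: "nat \<Rightarrow> mat_pair set set" where
  "CM_space n = CM_pairs n // CM_rel n"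

primrec word_eval :: "nat \<Rightarrow> mat_pair \<Rightarrow> letter list \<Rightarrow> complex mat" where
  "word_eval n v [] = 1\<^sub>m n"
| "word_eval n v (a # w) = (case a of Lx \<Rightarrow> fst v | Ly \<Rightarrow> snd v) * word_eval n v w"

definition subst_mat :: "nat \<Rightarrow> mat_pair \<Rightarrow> free_alg \<Rightarrow> complex mat" where
  "subst_mat n v p =
     mat n n (\<lambda>ij. \<Sum>w \<in> Poly_Mapping.keys p.
        Poly_Mapping.lookup p w * (word_eval n v (letters w) $$ ij))"

definition act_pair :: "nat \<Rightarrow> (free_alg \<Rightarrow> free_alg) \<Rightarrow> mat_pair \<Rightarrow> mat_pair" where
  "act_pair n \<sigma> v =
     (subst_mat n v (inv_into UNIV \<sigma> gen_x), subst_mat n v (inv_into UNIV \<sigma> gen_y))"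

definition act_CM :: "nat \<Rightarrow> (free_alg \<Rightarrow> free_alg) \<Rightarrow> mat_pair set \<Rightarrow> mat_pair set" where
  "act_CM n \<sigma> c = (\<Union>v \<in> c. CM_rel n `` {act_pair n \<sigma> v})"

text \<open>Rows and columns are numbered from \<open>0\<close> here: the entry of \<open>Y\<^sub>0\<close> in row \<open>r\<close> and column
  \<open>r + 1\<close> is the coefficient \<open>i - n\<close> of \<open>E\<^bsub>i,i+1\<^esub>\<close> for \<open>i = r + 1\<close>.\<close>

definition CM_X0 :: "nat \<Rightarrow> complex mat" where
  "CM_X0 n = mat n n (\<lambda>(r, c). if r = c + 1 then 1 else 0)"

definition CM_Y0 :: "nat \<Rightarrow> complex mat" where
  "CM_Y0 n = mat n n (\<lambda>(r, c). if c = r + 1 then of_nat (r + 1) - of_nat n else 0)"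

definition CM_base :: "nat \<Rightarrow> mat_pair set" where
  "CM_base n = CM_rel n `` {(CM_X0 n, CM_Y0 n)}"

lemma equiv_CM_rel: "equiv (CM_pairs n) (CM_rel n)"
proof (rule equivI)
  show "CM_rel n \<subseteq> CM_pairs n \<times> CM_pairs n"
    by (auto simp: CM_rel_def)
  show "refl_on (CM_pairs n) (CM_rel n)"
    by (auto simp: refl_on_def CM_rel_def CM_pairs_def intro: similar_mat_wit_refl)
  show "sym (CM_rel n)"
    by (auto simp: sym_def CM_rel_def intro: similar_mat_wit_sym)
  show "trans (CM_rel n)"
  proof (rule transI)
    fix u v w assume "(u, v) \<in> CM_rel n" "(v, w) \<in> CM_rel n"
    then show "(u, w) \<in> CM_rel n"
      unfolding CM_rel_def by (auto, meson similar_mat_wit_trans)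
  qed
qed

lemma CM_base_commutator:
  "(CM_X0 n * CM_Y0 n - CM_Y0 n * CM_X0 n) + 1\<^sub>m n =
     mat n n (\<lambda>(r, c). if r = 0 \<and> c = 0 then of_nat n else 0)"
proof (rule eq_matI)
  fix i j assume "i < dim_row (mat n n (\<lambda>(r, c). if r = 0 \<and> c = 0 then (of_nat n :: complex) else 0))"
    "j < dim_col (mat n n (\<lambda>(r, c). if r = 0 \<and> c = 0 then (of_nat n :: complex) else 0))"
  then have i: "i < n" and j: "j < n" by auto
  have "(CM_X0 n * CM_Y0 n) $$ (i, j) =
      (\<Sum>k \<in> {0..<n}. if i = k + 1 \<and> j = k + 1 then of_nat (k + 1) - of_nat n else 0)"
    using i j by (auto simp: CM_X0_def CM_Y0_def scalar_prod_def intro!: sum.cong)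
  also have "\<dots> = (\<Sum>k \<in> {0..<n}. if k = i - 1 then (if 0 < i \<and> j = i then of_nat i - of_nat n else 0) else 0)"
    by (intro sum.cong) auto
  also have "\<dots> = (if 0 < i \<and> j = i then of_nat i - of_nat n else 0)"
    using i by (subst sum.delta) auto
  finally have a: "(CM_X0 n * CM_Y0 n) $$ (i, j) = (if 0 < i \<and> j = i then of_nat i - of_nat n else 0)" .
  have "(CM_Y0 n * CM_X0 n) $$ (i, j) = (\<Sum>k \<in> {0..<n}. CM_Y0 n $$ (i, k) * CM_X0 n $$ (k, j))"
    using i j by (simp add: CM_X0_def CM_Y0_def scalar_prod_def)
  also have "\<dots> = (\<Sum>k \<in> {0..<n}. if k = i + 1 then (if i = j then of_nat (i + 1) - of_nat n else 0) else 0)"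
    using i j by (intro sum.cong) (auto simp: CM_X0_def CM_Y0_def)
  also have "\<dots> = (if i + 1 < n \<and> i = j then of_nat (i + 1) - of_nat n else 0)"
    by (subst sum.delta) auto
  finally have b: "(CM_Y0 n * CM_X0 n) $$ (i, j) =
      (if i + 1 < n \<and> i = j then of_nat (i + 1) - of_nat n else 0)" .
  have d: "CM_X0 n \<in> carrier_mat n n" "CM_Y0 n \<in> carrier_mat n n"
    by (auto simp: CM_X0_def CM_Y0_def)
  have "((CM_X0 n * CM_Y0 n - CM_Y0 n * CM_X0 n) + 1\<^sub>m n) $$ (i, j) =
      (CM_X0 n * CM_Y0 n) $$ (i, j) - (CM_Y0 n * CM_X0 n) $$ (i, j) + (if i = j then 1 else 0)"
    using i j d by (simp del: index_mult_mat(1) add: index_mult_mat(2,3))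
  also have "\<dots> = mat n n (\<lambda>(r, c). if r = 0 \<and> c = 0 then of_nat n else 0) $$ (i, j)"
  proof -
    have "of_nat n = (of_nat i + 1 :: complex)" if "\<not> i + 1 < n"
    proof -
      from that i have "n = i + 1" by simp
      then show ?thesis by simp
    qed
    then show ?thesis unfolding a b using i j by auto
  qed
  finally show "((CM_X0 n * CM_Y0 n - CM_Y0 n * CM_X0 n) + 1\<^sub>m n) $$ (i, j) =
      mat n n (\<lambda>(r, c). if r = 0 \<and> c = 0 then of_nat n else 0) $$ (i, j)" .
qed (auto simp: CM_X0_def CM_Y0_def)

lemma CM_base_in_CM_space:
  assumes "1 \<le> n"
  shows "CM_base n \<in> CM_space n"
proof -
  interpret vec_space "TYPE(complex)" n .
  define A :: "complex mat" where
    "A = mat n n (\<lambda>(r, c). if r = 0 \<and> c = 0 then of_nat n else 0)"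
  have A: "A \<in> carrier_mat n n" by (simp add: A_def)
  have "rank A \<le> 1"
    by (rule rank_le_1_product_entries[where f = "\<lambda>r. if r = 0 then of_nat n else 0"
          and g = "\<lambda>c. if c = 0 then 1 else 0"]) (use A in \<open>auto simp: A_def\<close>)
  moreover have "card {col A 0} \<le> rank A"
  proof (rule rank_ge_card_indpt[OF A])
    show "{col A 0} \<subseteq> set (cols A)"
      using A assms by (auto simp: cols_def)
    have v: "col A 0 $ 0 \<noteq> 0" using assms by (simp add: A_def)
    have c: "col A 0 \<in> carrier_vec n" using A by auto
    show "lin_indpt {col A 0}"
    proof
      assume "lin_dep {col A 0}"
      then obtain a w where "lincomb a {col A 0} = 0\<^sub>v n" "w = col A 0" "a w \<noteq> 0"
        using finite_lin_dep[of "{col A 0}"] c by auto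
      then have "a (col A 0) \<cdot>\<^sub>v col A 0 = 0\<^sub>v n"  "a (col A 0) \<noteq> 0"
        using c by (auto simp: lincomb_def)
      then have "a (col A 0) * (col A 0 $ 0) = 0"
        using c assms by (metis carrier_vecD index_smult_vec(1) index_zero_vec(1) less_eq_Suc_le One_nat_def)
      then show False using v \<open>a (col A 0) \<noteq> 0\<close> by simp
    qed
  qed
  ultimately have "rank A = 1" by simp
  then have "(CM_X0 n, CM_Y0 n) \<in> CM_pairs n"
    unfolding CM_pairs_def A_def CM_base_commutator[symmetric] by (simp add: CM_X0_def CM_Y0_def)
  then show ?thesis unfolding CM_base_def CM_space_def by (rule quotientI)
qed

definition G_stab :: "nat \<Rightarrow> (free_alg \<Rightarrow> free_alg) set" where
  "G_stab n = (if n = 0 then carrier Aut_comm else stabilizer Aut_comm (act_CM n) (CM_base n))"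

section \<open>The ind-Zariski topology\<close>

text \<open>Polynomial functions in the coefficients of a pair of elements. An individual
  polynomial involves finitely many coefficients, so the restrictions of these functions to
  \<^term>\<open>free_alg_upto k \<times> free_alg_upto k\<close> are precisely the polynomial functions on that
  finite-dimensional space.\<close>

inductive poly_fun :: "(free_alg \<times> free_alg \<Rightarrow> complex) \<Rightarrow> bool" where
  const: "poly_fun (\<lambda>v. c)"
| coord_fst: "poly_fun (\<lambda>v. Poly_Mapping.lookup (fst v) w)"
| coord_snd: "poly_fun (\<lambda>v. Poly_Mapping.lookup (snd v) w)"
| add: "poly_fun f \<Longrightarrow> poly_fun g \<Longrightarrow> poly_fun (\<lambda>v. f v + g v)"
| mult: "poly_fun f \<Longrightarrow> poly_fun g \<Longrightarrow> poly_fun (\<lambda>v. f v * g v)"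

definition zariski_closed_in ::
    "(free_alg \<times> free_alg) set \<Rightarrow> (free_alg \<times> free_alg) set \<Rightarrow> bool" where
  "zariski_closed_in V S \<longleftrightarrow>
     (\<exists>F. (\<forall>f \<in> F. poly_fun f) \<and> S = {v \<in> V. \<forall>f \<in> F. f v = 0})"

definition coords :: "(free_alg \<Rightarrow> free_alg) \<Rightarrow> free_alg \<times> free_alg" where
  "coords \<sigma> = (\<sigma> gen_x, \<sigma> gen_y)"

definition pairs_upto :: "nat \<Rightarrow> (free_alg \<times> free_alg) set" where
  "pairs_upto k = free_alg_upto k \<times> free_alg_upto k"

definition ind_zariski_closed :: "(free_alg \<Rightarrow> free_alg) set \<Rightarrow> bool" where
  "ind_zariski_closed S \<longleftrightarrow>
     S \<subseteq> carrier Aut_comm \<and>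
     (\<forall>k. zariski_closed_in (coords ` carrier Aut_comm \<inter> pairs_upto k)
                            (coords ` S \<inter> pairs_upto k))"

definition ind_zariski :: "(free_alg \<Rightarrow> free_alg) topology" where
  "ind_zariski = topology (\<lambda>U. U \<subseteq> carrier Aut_comm \<and> ind_zariski_closed (carrier Aut_comm - U))"

definition irreducible_space :: "'a topology \<Rightarrow> bool" where
  "irreducible_space T \<longleftrightarrow>
     topspace T \<noteq> {} \<and>
     (\<forall>A B. closedin T A \<and> closedin T B \<and> topspace T = A \<union> B \<longrightarrow>
        A = topspace T \<or> B = topspace T)"

subsection \<open>The closed sets form a topology\<close>

lemma free_alg_induct [case_names scalar gen_x gen_y add mult]:
  assumes "\<And>c. P (scalar c)" "P gen_x" "P gen_y"
    and "\<And>p q. P p \<Longrightarrow> P q \<Longrightarrow> P (p + q)"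
    and "\<And>p q. P p \<Longrightarrow> P q \<Longrightarrow> P (p * q)"
  shows "P p"
proof -
  have single: "P (Poly_Mapping.single (Word w) c)" for w c
  proof (induction w arbitrary: c)
    case Nil
    then show ?case using assms(1)[of c] by (simp add: scalar_def zero_nc_word_def)
  next
    case (Cons a w)
    have "Poly_Mapping.single (Word (a # w)) c =
        Poly_Mapping.single (Word [a]) 1 * Poly_Mapping.single (Word w) c"
      by (simp add: mult_single plus_nc_word_def)
    moreover have "P (Poly_Mapping.single (Word [a]) 1)"
      using assms(2,3) by (cases a) (simp_all add: gen_x_def gen_y_def)
    ultimately show ?case using assms(5) Cons.IH by simp
  qed
  have "P 0" using assms(1)[of 0] by (simp add: scalar_def)
  show ?thesis
  proof (induction p rule: Poly_Mapping.update_induct)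
    case const
    show ?case by fact
  next
    case (update p k c)
    have "Poly_Mapping.update k c p = Poly_Mapping.single k c + p"
      using update.hyps(1)
      by (intro poly_mapping_eqI)
        (auto simp: lookup_update lookup_add lookup_single in_keys_iff when_def)
    moreover have "P (Poly_Mapping.single k c)"
      using single[of "letters k" c] by simp
    ultimately show ?case using assms(4) update by simp
  qed
qed

lemma inj_on_coords: "inj_on coords (carrier Aut_comm)"
proof (rule inj_onI)
  fix \<sigma> \<tau> assume "\<sigma> \<in> carrier Aut_comm" "\<tau> \<in> carrier Aut_comm" and eq: "coords \<sigma> = coords \<tau>"
  then have s: "alg_automorphism \<sigma>" and t: "alg_automorphism \<tau>"
    by (auto simp: Aut_comm_def)
  have sc: "\<rho> (scalar c) = scalar c" if "alg_automorphism \<rho>" for \<rho> c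
  proof -
    have "\<rho> (scalar c * 1) = scalar c * \<rho> 1" and "\<rho> 1 = 1"
      using that unfolding alg_automorphism_def by blast+
    then show ?thesis by simp
  qed
  have "\<sigma> p = \<tau> p" for p
    using eq s t
    by (induction p rule: free_alg_induct)
      (auto simp: coords_def sc, auto simp: alg_automorphism_def)
  then show "\<sigma> = \<tau>" by blast
qed

lemma zariski_closed_in_empty: "zariski_closed_in V {}"
  unfolding zariski_closed_in_def
  by (rule exI[of _ "{\<lambda>v. 1}"]) (auto intro: poly_fun.intros)

lemma zariski_closed_in_Un:
  assumes "zariski_closed_in V S" "zariski_closed_in V T"
  shows "zariski_closed_in V (S \<union> T)"
proof -
  obtain F H where F: "\<forall>f \<in> F. poly_fun f" "S = {v \<in> V. \<forall>f \<in> F. f v = 0}"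
    and H: "\<forall>f \<in> H. poly_fun f" "T = {v \<in> V. \<forall>f \<in> H. f v = 0}"
    using assms unfolding zariski_closed_in_def by blast
  have "S \<union> T = {v \<in> V. \<forall>f \<in> {\<lambda>v. f v * h v | f h. f \<in> F \<and> h \<in> H}. f v = 0}"
    unfolding F H by fastforce
  moreover have "\<forall>f \<in> {\<lambda>v. f v * h v | f h. f \<in> F \<and> h \<in> H}. poly_fun f"
    using F H by (auto intro: poly_fun.mult)
  ultimately show ?thesis unfolding zariski_closed_in_def by blast
qed

lemma zariski_closed_in_Inter:
  assumes "\<And>S. S \<in> \<S> \<Longrightarrow> zariski_closed_in V S"
  shows "zariski_closed_in V (V \<inter> \<Inter>\<S>)"
proof -
  have "\<forall>S \<in> \<S>. \<exists>F. (\<forall>f \<in> F. poly_fun f) \<and> S = {v \<in> V. \<forall>f \<in> F. f v = 0}"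
    using assms unfolding zariski_closed_in_def by blast
  then obtain F where F: "\<forall>S \<in> \<S>. (\<forall>f \<in> F S. poly_fun f) \<and> S = {v \<in> V. \<forall>f \<in> F S. f v = 0}"
    by (rule bchoice[THEN exE])
  have "V \<inter> \<Inter>\<S> = {v \<in> V. \<forall>f \<in> \<Union>(F ` \<S>). f v = 0}"
  proof (rule Set.set_eqI)
    fix v
    have "v \<in> S \<longleftrightarrow> v \<in> V \<and> (\<forall>f \<in> F S. f v = 0)" if "S \<in> \<S>" for S
      using F that by blast
    then show "v \<in> V \<inter> \<Inter>\<S> \<longleftrightarrow> v \<in> {v \<in> V. \<forall>f \<in> \<Union>(F ` \<S>). f v = 0}"
      by auto
  qed
  then show ?thesis using F unfolding zariski_closed_in_def by (intro exI[of _ "\<Union>(F ` \<S>)"]) auto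
qed

lemma istopology_ind_zariski:
  "istopology (\<lambda>U. U \<subseteq> carrier Aut_comm \<and> ind_zariski_closed (carrier Aut_comm - U))"
proof -
  let ?G = "carrier Aut_comm"
  have "ind_zariski_closed (?G - (U \<inter> U'))"
    if U: "ind_zariski_closed (?G - U)" and U': "ind_zariski_closed (?G - U')" for U U'
  proof -
    have "coords ` (?G - (U \<inter> U')) \<inter> pairs_upto k =
        (coords ` (?G - U) \<inter> pairs_upto k) \<union> (coords ` (?G - U') \<inter> pairs_upto k)" for k
      by blast
    then show ?thesis
      using U U' unfolding ind_zariski_closed_def by (auto intro!: zariski_closed_in_Un)
  qed
  moreover have "ind_zariski_closed (?G - \<Union>\<K>)"
    if \<K>: "\<And>U. U \<in> \<K> \<Longrightarrow> U \<subseteq> ?G \<and> ind_zariski_closed (?G - U)" for \<K>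
  proof -
    have "zariski_closed_in (coords ` ?G \<inter> pairs_upto k) (coords ` (?G - \<Union>\<K>) \<inter> pairs_upto k)" for k
    proof -
      let ?V = "coords ` ?G \<inter> pairs_upto k"
      let ?S = "(\<lambda>U. coords ` (?G - U) \<inter> pairs_upto k) ` \<K>"
      have img: "coords ` (?G - W) = coords ` ?G - coords ` W" if "W \<subseteq> ?G" for W
        using that by (intro inj_on_image_set_diff[OF inj_on_coords]) auto
      have "\<Union>\<K> \<subseteq> ?G" using \<K> by blast
      then have e: "coords ` (?G - \<Union>\<K>) = coords ` ?G - \<Union>((`) coords ` \<K>)"
        by (subst img) auto
      have e': "?S = (\<lambda>U. (coords ` ?G - coords ` U) \<inter> pairs_upto k) ` \<K>"
        using \<K> by (intro image_cong refl) (subst img, auto)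
      have "coords ` (?G - \<Union>\<K>) \<inter> pairs_upto k = ?V \<inter> \<Inter>?S"
        unfolding e e' by blast
      moreover have "zariski_closed_in ?V (?V \<inter> \<Inter>?S)"
        using \<K> by (intro zariski_closed_in_Inter) (auto simp: ind_zariski_closed_def)
      ultimately show ?thesis by simp
    qed
    then show ?thesis by (auto simp: ind_zariski_closed_def)
  qed
  ultimately show ?thesis unfolding istopology_def by blast
qed

lemma openin_ind_zariski:
  "openin ind_zariski U \<longleftrightarrow>
     U \<subseteq> carrier Aut_comm \<and> ind_zariski_closed (carrier Aut_comm - U)"
  unfolding ind_zariski_def by (simp add: topology_inverse'[OF istopology_ind_zariski])

lemma topspace_ind_zariski: "topspace ind_zariski = carrier Aut_comm"
proof -
  have "openin ind_zariski (carrier Aut_comm)"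
    by (simp add: openin_ind_zariski ind_zariski_closed_def zariski_closed_in_empty)
  then have "carrier Aut_comm \<subseteq> topspace ind_zariski"
    by (rule openin_subset)
  moreover have "topspace ind_zariski \<subseteq> carrier Aut_comm"
    using openin_topspace[of ind_zariski] unfolding openin_ind_zariski by (rule conjunct1)
  ultimately show ?thesis by (rule equalityI[rotated])
qed

lemma closedin_ind_zariski: "closedin ind_zariski S \<longleftrightarrow> ind_zariski_closed S"
proof -
  have "carrier Aut_comm - (carrier Aut_comm - S) = S" if "S \<subseteq> carrier Aut_comm"
    using that by blast
  then show ?thesis
    by (auto simp: closedin_def topspace_ind_zariski openin_ind_zariski ind_zariski_closed_def)
qed

end

theory Submission
  imports "HOL-Complex_Analysis.Conformal_Mappings" Defs
begin

text \<open>
  The groups are irreducible because any two of their elements lie on a common curve, the image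
  of an irreducible parameter space. The parameter space used here is the complex line with
  \<^emph>\<open>entire\<close> functions as coefficients, rather than an algebraic curve: entire functions form an
  integral domain, so two closed sets that cover such a curve cannot both miss points of it
  (\<open>closed_covers_curve\<close>), and the exponential function connects the elements of a torus. As
  \<open>G\<^sub>n\<close> is a group, it suffices to join every element to the identity inside \<open>G\<^sub>n\<close>
  (\<open>irreducible_if_curve_connected\<close>).

  Conjugating \<open>\<sigma> \<in> G\<close> by the dilation \<open>x \<mapsto> t x, y \<mapsto> t y\<close> multiplies the terms of degree \<open>d\<close> of
  \<open>\<sigma>(x)\<close> and \<open>\<sigma>(y)\<close> by \<open>t\<^sup>d\<^sup>-\<^sup>1\<close>, and it preserves the condition on \<open>[x, y]\<close> because a commutator is
  homogeneous of degree two. If the constant terms are kept in place, the exponents are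
  nonnegative, and \<open>\<sigma>\<close> is deformed inside \<open>G\<close> to its affine part as \<open>t \<longlongrightarrow> 0\<close>
  (\<open>contraction_in_Aut_comm\<close>). The affine elements of \<open>G\<close> form \<open>SL\<^sub>2 \<ltimes> \<complex>\<^sup>2\<close>, where curves can be
  written down (\<open>SL2_entire_path\<close>). This settles \<open>n = 0\<close>. It also settles \<open>n = 1\<close>: the group \<open>G\<^sub>1\<close>
  consists of the elements without constant terms, and the deformation keeps the constant terms.

  For \<open>n = 2\<close> the deformation leaves \<open>G\<^sub>2\<close> and has to be corrected. Every \<open>\<sigma> \<in> G\<close> satisfies
  \<open>[\<sigma>(X\<^sub>0), \<sigma>(Y\<^sub>0)] = [X\<^sub>0, Y\<^sub>0]\<close>, a diagonal matrix with the eigenvalues \<open>1\<close> and \<open>-1\<close>. For matrices of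
  size two this forces \<open>\<sigma>(X\<^sub>0)\<close> and \<open>\<sigma>(Y\<^sub>0)\<close> to be combinations of \<open>1, X\<^sub>0, Y\<^sub>0\<close>, with coefficients
  that define an affine element \<open>\<alpha>(\<sigma>)\<close> of \<open>G\<close> with the same effect on \<open>(X\<^sub>0, Y\<^sub>0)\<close> as \<open>\<sigma>\<close>
  (\<open>image_pair_2_affine\<close>). If \<open>\<sigma>\<^sub>t\<close> denotes the deformation, then
  \<open>\<sigma>\<^sub>t \<circ> \<alpha>(\<sigma>\<^sub>t)\<^sup>-\<^sup>1\<close> fixes the pair \<open>(X\<^sub>0, Y\<^sub>0)\<close> itself; it is a curve in \<open>G\<^sub>2\<close> from the
  identity at \<open>t = 0\<close> to \<open>\<sigma> \<circ> \<alpha>(\<sigma>)\<^sup>-\<^sup>1\<close> at \<open>t = 1\<close>. The remaining factor \<open>\<alpha>(\<sigma>)\<close> is an affine element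
  of \<open>G\<^sub>2\<close>, and these form the diagonal torus of \<open>SL\<^sub>2\<close> (\<open>affine_map_G_stab_2_iff\<close>).
\<close>

section \<open>Substitution endomorphisms of the free algebra\<close>

lemma free_alg_single_induct [case_names single add]:
  fixes p :: free_alg
  assumes single: "\<And>w c. P (Poly_Mapping.single w c)"
    and add: "\<And>p q. P p \<Longrightarrow> P q \<Longrightarrow> P (p + q)"
  shows "P p"
proof (induction p rule: Poly_Mapping.update_induct)
  case const
  show ?case using single[of 0 0] by simp
next
  case (update p k c)
  have "Poly_Mapping.update k c p = Poly_Mapping.single k c + p"
    using update.hyps(1)
    by (intro poly_mapping_eqI)
      (auto simp: lookup_update lookup_add lookup_single in_keys_iff when_def)
  then show ?case using add single update by simp
qed

lemma scalar_simps:
  "scalar 0 = 0" "scalar 1 = 1"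
  "scalar a * scalar b = scalar (a * b)" "scalar a + scalar b = scalar (a + b)"
  "scalar a - scalar b = scalar (a - b)"
  by (simp_all add: scalar_def mult_single single_add single_diff)

lemma scalar_central: "p * scalar c = scalar c * p"
  by (induction p rule: free_alg_single_induct)
    (simp_all add: scalar_def mult_single algebra_simps)

lemma scalar_central': "p * (scalar c * q) = scalar c * (p * q)"
  by (metis scalar_central mult.assoc)

lemma scalar_mult_mult: "scalar a * (scalar b * q) = scalar (a * b) * q"
  by (metis scalar_simps(3) mult.assoc)

definition alg_hom :: "(free_alg \<Rightarrow> free_alg) \<Rightarrow> bool" where
  "alg_hom \<phi> \<longleftrightarrow>
     (\<forall>p q. \<phi> (p + q) = \<phi> p + \<phi> q) \<and> (\<forall>p q. \<phi> (p * q) = \<phi> p * \<phi> q) \<and>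
     (\<forall>c. \<phi> (scalar c) = scalar c)"

lemma alg_homD:
  assumes "alg_hom \<phi>"
  shows "\<phi> (p + q) = \<phi> p + \<phi> q" "\<phi> (p * q) = \<phi> p * \<phi> q" "\<phi> (scalar c) = scalar c"
    "\<phi> (p - q) = \<phi> p - \<phi> q" "\<phi> 1 = 1" "\<phi> (commutator p q) = commutator (\<phi> p) (\<phi> q)"
proof -
  show a: "\<phi> (p + q) = \<phi> p + \<phi> q" "\<phi> (p * q) = \<phi> p * \<phi> q" "\<phi> (scalar c) = scalar c" for p q c
    using assms by (auto simp: alg_hom_def)
  show d: "\<phi> (p - q) = \<phi> p - \<phi> q" for p q
    using a(1)[of "p - q" q] by (simp add: algebra_simps)
  show "\<phi> 1 = 1" using a(3)[of 1] by (simp add: scalar_simps)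
  show "\<phi> (commutator p q) = commutator (\<phi> p) (\<phi> q)"
    by (simp add: commutator_def a d)
qed

lemma alg_automorphism_iff: "alg_automorphism \<sigma> \<longleftrightarrow> bij \<sigma> \<and> alg_hom \<sigma>"
proof
  assume a: "alg_automorphism \<sigma>"
  then have "\<sigma> (scalar c * 1) = scalar c * \<sigma> 1" "\<sigma> 1 = 1" for c
    unfolding alg_automorphism_def by blast+
  with a show "bij \<sigma> \<and> alg_hom \<sigma>"
    by (auto simp: alg_automorphism_def alg_hom_def)
next
  assume "bij \<sigma> \<and> alg_hom \<sigma>"
  then show "alg_automorphism \<sigma>"
    by (auto simp: alg_automorphism_def alg_homD)
qed

lemma alg_hom_eqI:
  assumes "alg_hom \<phi>" "alg_hom \<psi>" "\<phi> gen_x = \<psi> gen_x" "\<phi> gen_y = \<psi> gen_y"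
  shows "\<phi> = \<psi>"
proof
  fix p show "\<phi> p = \<psi> p"
    by (induction p rule: free_alg_induct) (simp_all add: assms alg_homD)
qed

lemma alg_hom_id: "alg_hom id"
  by (simp add: alg_hom_def)

lemma alg_hom_comp: "alg_hom \<phi> \<Longrightarrow> alg_hom \<psi> \<Longrightarrow> alg_hom (\<phi> \<circ> \<psi>)"
  by (simp add: alg_hom_def)

primrec word_image :: "free_alg \<Rightarrow> free_alg \<Rightarrow> letter list \<Rightarrow> free_alg" where
  "word_image u v [] = 1"
| "word_image u v (a # w) = (case a of Lx \<Rightarrow> u | Ly \<Rightarrow> v) * word_image u v w"

definition subst_alg :: "free_alg \<Rightarrow> free_alg \<Rightarrow> free_alg \<Rightarrow> free_alg" where
  "subst_alg u v p =
     (\<Sum>w \<in> Poly_Mapping.keys p. scalar (Poly_Mapping.lookup p w) * word_image u v (letters w))"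

lemma word_image_append: "word_image u v (w @ w') = word_image u v w * word_image u v w'"
  by (induction w) (simp_all add: mult.assoc)

lemma subst_alg_add: "subst_alg u v (p + q) = subst_alg u v p + subst_alg u v q"
  unfolding subst_alg_def
  by (intro setsum_keys_plus_distrib)
    (simp_all add: scalar_simps(1) distrib_right flip: scalar_simps(4))

lemma subst_alg_single:
  "subst_alg u v (Poly_Mapping.single w c) = scalar c * word_image u v (letters w)"
  by (simp add: subst_alg_def scalar_simps)

lemma subst_alg_mult: "subst_alg u v (p * q) = subst_alg u v p * subst_alg u v q"
proof (induction p rule: free_alg_single_induct)
  case (single w c)
  show ?case
  proof (induction q rule: free_alg_single_induct)
    case (single w' c')
    show ?case
      by (simp add: mult_single subst_alg_single plus_nc_word_def word_image_append
          scalar_central'[of "word_image u v _"] mult.assoc flip: scalar_simps(3))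
  qed (simp add: subst_alg_add distrib_left)
qed (simp add: subst_alg_add distrib_right)

lemma alg_hom_subst_alg: "alg_hom (subst_alg u v)"
proof -
  have "subst_alg u v (scalar c) = scalar c" for c
    unfolding scalar_def[of c] subst_alg_single by (simp add: zero_nc_word_def scalar_def)
  then show ?thesis by (simp add: alg_hom_def subst_alg_add subst_alg_mult)
qed

lemma subst_alg_gens: "subst_alg u v gen_x = u" "subst_alg u v gen_y = v"
  by (simp_all add: gen_x_def gen_y_def subst_alg_single scalar_simps)

text \<open>Substituting the images of the generators recovers any endomorphism, so a curve of endomorphisms
  is given by two curves in the algebra.\<close>

lemma alg_hom_eq_subst_alg: "alg_hom \<phi> \<Longrightarrow> \<phi> = subst_alg (\<phi> gen_x) (\<phi> gen_y)"
  by (intro alg_hom_eqI) (simp_all add: alg_hom_subst_alg subst_alg_gens)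

section \<open>Affine automorphisms\<close>

text \<open>The element \<open>a + p x + q y\<close>; an affine map is described by six numbers, first the coefficients
  of the image of \<open>x\<close>, then those of the image of \<open>y\<close>.\<close>

definition affine :: "complex \<Rightarrow> complex \<Rightarrow> complex \<Rightarrow> free_alg" where
  "affine a p q = scalar a + scalar p * gen_x + scalar q * gen_y"

definition affine_map ::
    "complex \<Rightarrow> complex \<Rightarrow> complex \<Rightarrow> complex \<Rightarrow> complex \<Rightarrow> complex \<Rightarrow> free_alg \<Rightarrow> free_alg" where
  "affine_map a p q b r s = subst_alg (affine a p q) (affine b r s)"

lemma gens_affine: "gen_x = affine 0 1 0" "gen_y = affine 0 0 1"
  by (simp_all add: affine_def scalar_simps)

lemma alg_hom_affine_map: "alg_hom (affine_map a p q b r s)"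
  by (simp add: affine_map_def alg_hom_subst_alg)

lemma affine_map_gens:
  "affine_map a p q b r s gen_x = affine a p q" "affine_map a p q b r s gen_y = affine b r s"
  by (simp_all add: affine_map_def subst_alg_gens)

lemma alg_hom_affine:
  "alg_hom \<phi> \<Longrightarrow> \<phi> (affine a p q) = scalar a + scalar p * \<phi> gen_x + scalar q * \<phi> gen_y"
  by (simp add: affine_def alg_homD)

lemma affine_comb:
  "scalar c + scalar d * affine a p q + scalar e * affine b r s =
     affine (c + d * a + e * b) (d * p + e * r) (d * q + e * s)"
  by (simp add: affine_def distrib_left distrib_right scalar_mult_mult add_ac scalar_simps(3)
      flip: scalar_simps(4))

lemma affine_map_comp:
  "affine_map a p q b r s \<circ> affine_map a' p' q' b' r' s' =
     affine_map (a' + p' * a + q' * b) (p' * p + q' * r) (p' * q + q' * s)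
                (b' + r' * a + s' * b) (r' * p + s' * r) (r' * q + s' * s)"
  by (rule alg_hom_eqI)
    (simp_all add: alg_hom_comp alg_hom_affine_map affine_map_gens affine_comb
      alg_hom_affine[OF alg_hom_affine_map])

lemma affine_map_id: "affine_map 0 1 0 0 0 1 = id"
  by (rule alg_hom_eqI)
    (simp_all add: alg_hom_affine_map alg_hom_id affine_map_gens flip: gens_affine)

lemma affine_map_cong:
  assumes "a = a'" "p = p'" "q = q'" "b = b'" "r = r'" "s = s'"
  shows "affine_map a p q b r s = affine_map a' p' q' b' r' s'"
  using assms by simp

lemma affine_map_inverse:
  assumes "p * s - q * r = 1"
  shows "affine_map a p q b r s \<circ> affine_map (q * b - s * a) s (- q) (r * a - p * b) (- r) p = id"
    and "affine_map (q * b - s * a) s (- q) (r * a - p * b) (- r) p \<circ> affine_map a p q b r s = id"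
proof -
  have e: "p * s = 1 + q * r" using assms by (simp add: algebra_simps)
  show "affine_map a p q b r s \<circ> affine_map (q * b - s * a) s (- q) (r * a - p * b) (- r) p = id"
    unfolding affine_map_comp affine_map_id[symmetric]
    by (intro affine_map_cong) (use e in \<open>simp_all add: algebra_simps\<close>)
  have "a + p * (q * b - s * a) + q * (r * a - p * b) = a * (1 - (p * s - q * r))"
    "b + r * (q * b - s * a) + s * (r * a - p * b) = b * (1 - (p * s - q * r))"
    by (simp_all add: algebra_simps)
  then show "affine_map (q * b - s * a) s (- q) (r * a - p * b) (- r) p \<circ> affine_map a p q b r s = id"
    unfolding affine_map_comp affine_map_id[symmetric] assms
    by (intro affine_map_cong) (use e in \<open>simp_all add: algebra_simps\<close>)
qed

lemma commutator_affine:
  "commutator (affine a p q) (affine b r s) = scalar (p * s - q * r) * commutator gen_x gen_y"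
  by (simp add: commutator_def affine_def distrib_left distrib_right left_diff_distrib
      right_diff_distrib mult.assoc scalar_central[of gen_x] scalar_central[of gen_y]
      scalar_central'[of gen_x] scalar_central'[of gen_y] scalar_mult_mult scalar_simps(3)
      mult.commute[of _ "_ :: complex"] flip: scalar_simps(5))

lemma carrier_Aut_comm_iff:
  "\<sigma> \<in> carrier Aut_comm \<longleftrightarrow>
     bij \<sigma> \<and> alg_hom \<sigma> \<and> commutator (\<sigma> gen_x) (\<sigma> gen_y) = commutator gen_x gen_y"
  by (auto simp: Aut_comm_def alg_automorphism_iff alg_homD)

lemma affine_map_in_Aut_comm:
  assumes "p * s - q * r = 1"
  shows "affine_map a p q b r s \<in> carrier Aut_comm"
  unfolding carrier_Aut_comm_iff
  using o_bij[OF affine_map_inverse(2,1)[OF assms]] 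
  by (simp add: alg_hom_affine_map affine_map_gens commutator_affine assms scalar_simps)

section \<open>Entire curves and irreducibility\<close>

text \<open>A polynomial with entire coefficients. Requiring finitely many words for all \<open>t\<close> at once, as this
  inductive form does, gives the bound on the degree that places the whole family in one of the
  finite-dimensional pieces on which closed sets are defined.\<close>

inductive entire_family :: "(complex \<Rightarrow> free_alg) \<Rightarrow> bool" where
  single: "f holomorphic_on UNIV \<Longrightarrow> entire_family (\<lambda>t. Poly_Mapping.single w (f t))"
| add: "entire_family P \<Longrightarrow> entire_family Q \<Longrightarrow> entire_family (\<lambda>t. P t + Q t)"

lemma entire_family_const: "entire_family (\<lambda>t. p)"
  by (induction p rule: free_alg_single_induct) (auto intro: entire_family.intros)

lemma entire_family_scalar: "f holomorphic_on UNIV \<Longrightarrow> entire_family (\<lambda>t. scalar (f t))"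
  unfolding scalar_def by (rule entire_family.single)

lemma entire_family_mult:
  assumes "entire_family P" "entire_family Q"
  shows "entire_family (\<lambda>t. P t * Q t)"
  using assms
proof (induction rule: entire_family.induct)
  case (single f w)
  from single(2,1) show ?case
    by (induction rule: entire_family.induct)
      (auto simp: mult_single distrib_left intro!: entire_family.intros holomorphic_intros)
qed (auto simp: distrib_right intro: entire_family.add)

lemma entire_family_sum:
  "(\<And>i. i \<in> I \<Longrightarrow> entire_family (P i)) \<Longrightarrow> entire_family (\<lambda>t. \<Sum>i\<in>I. P i t)"
  by (induction I rule: infinite_finite_induct)
    (auto intro: entire_family.add entire_family_const)

lemma entire_family_affine:
  "f holomorphic_on UNIV \<Longrightarrow> g holomorphic_on UNIV \<Longrightarrow> h holomorphic_on UNIV \<Longrightarrow>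
     entire_family (\<lambda>t. affine (f t) (g t) (h t))"
  unfolding affine_def
  by (intro entire_family.add entire_family_mult entire_family_scalar entire_family_const)

lemma entire_family_subst_alg:
  assumes "entire_family U" "entire_family V" "entire_family P"
  shows "entire_family (\<lambda>t. subst_alg (U t) (V t) (P t))"
  using assms(3)
proof (induction rule: entire_family.induct)
  case (single f w)
  have "entire_family (\<lambda>t. word_image (U t) (V t) l)" for l
  proof (induction l)
    case (Cons a l)
    then show ?case
      by (cases a) (auto intro: entire_family_mult assms(1,2))
  qed (simp add: entire_family_const)
  then show ?case
    unfolding subst_alg_single by (intro entire_family_mult entire_family_scalar single)
qed (auto simp: subst_alg_add intro: entire_family.add)

lemma holomorphic_lookup_entire_family:
  "entire_family P \<Longrightarrow> (\<lambda>t. Poly_Mapping.lookup (P t) w) holomorphic_on UNIV"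
proof (induction rule: entire_family.induct)
  case (single f v)
  then show ?case by (cases "v = w") (simp_all add: lookup_single)
qed (auto simp: lookup_add intro: holomorphic_intros)

lemma free_alg_upto_mono: "k \<le> l \<Longrightarrow> free_alg_upto k \<subseteq> free_alg_upto l"
  by (auto simp: free_alg_upto_def)

lemma entire_family_bounded:
  "entire_family P \<Longrightarrow> \<exists>k. \<forall>t. P t \<in> free_alg_upto k"
proof (induction rule: entire_family.induct)
  case (single f w)
  have "Poly_Mapping.single w (f t) \<in> free_alg_upto (length (letters w))" for t
    by (simp add: free_alg_upto_def)
  then show ?case by blast
next
  case (add P Q)
  then obtain k l where kl: "\<forall>t. P t \<in> free_alg_upto k" "\<forall>t. Q t \<in> free_alg_upto l" by blast
  have "P t + Q t \<in> free_alg_upto (max k l)" for t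
  proof -
    have "P t \<in> free_alg_upto (max k l)" "Q t \<in> free_alg_upto (max k l)"
      using kl free_alg_upto_mono[of k "max k l"] free_alg_upto_mono[of l "max k l"] by auto
    then show ?thesis
      using Poly_Mapping.keys_add[of "P t" "Q t"] unfolding free_alg_upto_def by blast
  qed
  then show ?case by blast
qed

definition entire_curve :: "(complex \<Rightarrow> free_alg \<Rightarrow> free_alg) \<Rightarrow> bool" where
  "entire_curve \<gamma> \<longleftrightarrow>
     (\<forall>t. alg_hom (\<gamma> t)) \<and>
     entire_family (\<lambda>t. \<gamma> t gen_x) \<and> entire_family (\<lambda>t. \<gamma> t gen_y)"

lemma entire_curve_comp:
  assumes "entire_curve \<gamma>" "entire_curve \<delta>"
  shows "entire_curve (\<lambda>t. \<gamma> t \<circ> \<delta> t)"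
proof -
  have h: "alg_hom (\<gamma> t)" "alg_hom (\<delta> t)" for t
    using assms by (auto simp: entire_curve_def)
  have e: "\<gamma> t p = subst_alg (\<gamma> t gen_x) (\<gamma> t gen_y) p" for t p
    using alg_hom_eq_subst_alg[OF h(1)] by metis
  have "entire_family (\<lambda>t. subst_alg (\<gamma> t gen_x) (\<gamma> t gen_y) (P t))"
    if "entire_family P" for P
    using assms that by (auto simp: entire_curve_def intro: entire_family_subst_alg)
  then have "entire_family (\<lambda>t. \<gamma> t (P t))" if "entire_family P" for P
    using that by (simp flip: e)
  then show ?thesis
    using assms(2) by (simp add: entire_curve_def alg_hom_comp h)
qed

lemma entire_curve_const: "alg_hom \<phi> \<Longrightarrow> entire_curve (\<lambda>t. \<phi>)"
  by (simp add: entire_curve_def entire_family_const)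

lemma entire_curve_affine_map:
  assumes "a holomorphic_on UNIV" "p holomorphic_on UNIV" "q holomorphic_on UNIV"
    "b holomorphic_on UNIV" "r holomorphic_on UNIV" "s holomorphic_on UNIV"
  shows "entire_curve (\<lambda>t. affine_map (a t) (p t) (q t) (b t) (r t) (s t))"
  using assms
  by (simp add: entire_curve_def alg_hom_affine_map affine_map_gens entire_family_affine)

lemma holomorphic_poly_fun_curve:
  assumes "poly_fun f" "entire_curve \<gamma>"
  shows "(\<lambda>t. f (coords (\<gamma> t))) holomorphic_on UNIV"
  using assms(1)
  by (induction rule: poly_fun.induct)
    (use assms(2) in \<open>auto simp: coords_def entire_curve_def
      intro!: holomorphic_intros holomorphic_lookup_entire_family\<close>)

text \<open>The first function is nonzero on a nonempty open set, so the second vanishes there, and hence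
  everywhere by the identity theorem.\<close>

lemma entire_no_zero_divisors:
  fixes f g :: "complex \<Rightarrow> complex"
  assumes "f holomorphic_on UNIV" "g holomorphic_on UNIV" "\<And>t. f t * g t = 0" "f u \<noteq> 0"
  shows "g z = 0"
proof (rule analytic_continuation_open[where s = "{t. f t \<noteq> 0}" and s' = UNIV and f = g and g = "\<lambda>_. 0"])
  have "continuous_on UNIV f" using assms(1) by (rule holomorphic_on_imp_continuous_on)
  then show "open {t. f t \<noteq> 0}" by (intro open_Collect_neq) auto
  show "{t. f t \<noteq> 0} \<noteq> {}" using assms(4) by blast
  show "\<And>t. t \<in> {t. f t \<noteq> 0} \<Longrightarrow> g t = 0" using assms(3) by auto
qed (use assms(2) in auto)

definition curve_connected :: "(free_alg \<Rightarrow> free_alg) set \<Rightarrow> (free_alg \<Rightarrow> free_alg) \<Rightarrow> bool" where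
  "curve_connected S g \<longleftrightarrow> (\<exists>\<gamma>. entire_curve \<gamma> \<and> range \<gamma> \<subseteq> S \<and> \<gamma> 0 = id \<and> \<gamma> 1 = g)"

text \<open>A closed set that misses a point of the curve admits a polynomial that vanishes on the set but not
  at this point. If neither closed set contained the whole curve, the product of two such
  polynomials would restrict to the zero function of \<open>t\<close>, although neither factor does.\<close>

lemma closed_covers_curve:
  assumes C: "ind_zariski_closed C" and D: "ind_zariski_closed D"
    and \<gamma>: "entire_curve \<gamma>" "range \<gamma> \<subseteq> C \<union> D"
    and u: "\<gamma> u \<notin> C"
  shows "\<gamma> v \<in> D"
proof (rule ccontr)
  assume v: "\<gamma> v \<notin> D"
  have CG: "C \<subseteq> carrier Aut_comm" "D \<subseteq> carrier Aut_comm"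
    using C D by (auto simp: ind_zariski_closed_def)
  then have G: "\<gamma> t \<in> carrier Aut_comm" for t using \<gamma>(2) by blast
  obtain k l where kl: "\<forall>t. \<gamma> t gen_x \<in> free_alg_upto k" "\<forall>t. \<gamma> t gen_y \<in> free_alg_upto l"
    using \<gamma>(1) entire_family_bounded unfolding entire_curve_def by meson
  let ?V = "coords ` carrier Aut_comm \<inter> pairs_upto (max k l)"
  have V: "coords (\<gamma> t) \<in> ?V" for t
    using G kl free_alg_upto_mono[of k "max k l"] free_alg_upto_mono[of l "max k l"]
    by (auto simp: coords_def pairs_upto_def)
  have sep: "\<exists>f. poly_fun f \<and> f (coords (\<gamma> w)) \<noteq> 0 \<and> (\<forall>t. \<gamma> t \<in> E \<longrightarrow> f (coords (\<gamma> t)) = 0)"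
    if E: "ind_zariski_closed E" and w: "\<gamma> w \<notin> E" for E w
  proof -
    obtain F where F: "\<forall>f \<in> F. poly_fun f"
      "coords ` E \<inter> pairs_upto (max k l) = {v \<in> ?V. \<forall>f \<in> F. f v = 0}"
      using E unfolding ind_zariski_closed_def zariski_closed_in_def by meson
    have mem: "\<gamma> t \<in> E \<longleftrightarrow> (\<forall>f \<in> F. f (coords (\<gamma> t)) = 0)" for t
    proof -
      have "\<gamma> t \<in> E \<longleftrightarrow> coords (\<gamma> t) \<in> coords ` E"
        using E G[of t] inj_on_image_mem_iff[OF inj_on_coords, of "\<gamma> t" E]
        by (auto simp: ind_zariski_closed_def)
      also have "\<dots> \<longleftrightarrow> coords (\<gamma> t) \<in> coords ` E \<inter> pairs_upto (max k l)"
        using V[of t] by blast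
      also have "\<dots> \<longleftrightarrow> (\<forall>f \<in> F. f (coords (\<gamma> t)) = 0)"
        unfolding F(2) using V[of t] by blast
      finally show ?thesis .
    qed
    from w mem obtain f where "f \<in> F" "f (coords (\<gamma> w)) \<noteq> 0" by blast
    then show ?thesis using F(1) mem by blast
  qed
  obtain f where f: "poly_fun f" "f (coords (\<gamma> u)) \<noteq> 0" "\<forall>t. \<gamma> t \<in> C \<longrightarrow> f (coords (\<gamma> t)) = 0"
    using sep[OF C u] by blast
  obtain g where g: "poly_fun g" "g (coords (\<gamma> v)) \<noteq> 0" "\<forall>t. \<gamma> t \<in> D \<longrightarrow> g (coords (\<gamma> t)) = 0"
    using sep[OF D v] by blast
  have "f (coords (\<gamma> t)) * g (coords (\<gamma> t)) = 0" for t
    using \<gamma>(2) f(3) g(3) by auto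
  then have "g (coords (\<gamma> v)) = 0"
    using entire_no_zero_divisors[OF holomorphic_poly_fun_curve[OF f(1) \<gamma>(1)]
        holomorphic_poly_fun_curve[OF g(1) \<gamma>(1)]] f(2) by blast
  with g(2) show False by contradiction
qed

lemma Aut_comm_simps: "x \<otimes>\<^bsub>Aut_comm\<^esub> y = x \<circ> y" "\<one>\<^bsub>Aut_comm\<^esub> = id"
  by (simp_all add: Aut_comm_def)

lemma inv_Aut_comm:
  assumes "\<sigma> \<in> carrier Aut_comm"
  shows "inv\<^bsub>Aut_comm\<^esub> \<sigma> = inv_into UNIV \<sigma>" "inv_into UNIV \<sigma> \<in> carrier Aut_comm"
proof -
  interpret group Aut_comm by (rule group_Aut_comm)
  have b: "bij \<sigma>" using assms by (simp add: carrier_Aut_comm_iff)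
  have "\<sigma> \<circ> inv\<^bsub>Aut_comm\<^esub> \<sigma> = id" using r_inv[OF assms] by (simp add: Aut_comm_simps)
  then show "inv\<^bsub>Aut_comm\<^esub> \<sigma> = inv_into UNIV \<sigma>"
    using b by (metis bij_is_inj comp_assoc id_comp inv_o_cancel comp_id)
  then show "inv_into UNIV \<sigma> \<in> carrier Aut_comm" using inv_closed[OF assms] by simp
qed

text \<open>Left translation turns a curve from the identity to \<open>a\<^sup>-\<^sup>1 b\<close> into a curve from \<open>a\<close> to \<open>b\<close>. If
  two closed sets cover \<open>S\<close> and miss \<open>a\<close> and \<open>b\<close> respectively, such a curve is a contradiction.\<close>

lemma irreducible_if_curve_connected:
  assumes S: "subgroup S Aut_comm" and conn: "\<And>g. g \<in> S \<Longrightarrow> curve_connected S g"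
  shows "irreducible_space (subtopology ind_zariski S)"
proof -
  interpret group Aut_comm by (rule group_Aut_comm)
  have SG: "S \<subseteq> carrier Aut_comm" using S by (rule subgroup.subset)
  then have top: "topspace (subtopology ind_zariski S) = S"
    by (auto simp: topspace_ind_zariski)
  have join: "\<exists>\<gamma>. entire_curve \<gamma> \<and> range \<gamma> \<subseteq> S \<and> \<gamma> 0 = a \<and> \<gamma> 1 = b"
    if a: "a \<in> S" and b: "b \<in> S" for a b
  proof -
    have "inv\<^bsub>Aut_comm\<^esub> a \<otimes>\<^bsub>Aut_comm\<^esub> b \<in> S"
      using S a b by (simp add: subgroup.m_closed subgroup.m_inv_closed)
    then obtain \<gamma> where \<gamma>: "entire_curve \<gamma>" "range \<gamma> \<subseteq> S" "\<gamma> 0 = id"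
      "\<gamma> 1 = inv\<^bsub>Aut_comm\<^esub> a \<otimes>\<^bsub>Aut_comm\<^esub> b"
      using conn unfolding curve_connected_def by blast
    have "a \<otimes>\<^bsub>Aut_comm\<^esub> \<gamma> t \<in> S" for t
      using S a \<gamma>(2) by (simp add: subgroup.m_closed range_subsetD)
    moreover have "a \<otimes>\<^bsub>Aut_comm\<^esub> \<gamma> 1 = b"
      using subsetD[OF SG a] subsetD[OF SG b] by (simp add: \<gamma>(4) m_assoc[symmetric])
    moreover have "entire_curve (\<lambda>t. a \<circ> \<gamma> t)"
      using a SG by (intro entire_curve_comp entire_curve_const \<gamma>(1)) (auto simp: carrier_Aut_comm_iff)
    ultimately show ?thesis
      using \<gamma>(3) by (intro exI[of _ "\<lambda>t. a \<circ> \<gamma> t"]) (auto simp: Aut_comm_simps)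
  qed
  have "A = S \<or> B = S"
    if A: "closedin (subtopology ind_zariski S) A" and B: "closedin (subtopology ind_zariski S) B"
      and AB: "S = A \<union> B" for A B
  proof (rule ccontr)
    assume "\<not> (A = S \<or> B = S)"
    then obtain a b where ab: "a \<in> S" "a \<notin> A" "b \<in> S" "b \<notin> B" using AB by blast
    obtain C D where C: "ind_zariski_closed C" "A = C \<inter> S" and D: "ind_zariski_closed D" "B = D \<inter> S"
      using A B unfolding closedin_subtopology closedin_ind_zariski by blast
    obtain \<gamma> where \<gamma>: "entire_curve \<gamma>" "range \<gamma> \<subseteq> S" "\<gamma> 0 = a" "\<gamma> 1 = b"
      using join ab by blast
    have "range \<gamma> \<subseteq> C \<union> D" using \<gamma>(2) AB C(2) D(2) by blast
    moreover have "\<gamma> 0 \<notin> C" using ab(1,2) C(2) \<gamma>(3) by blast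
    ultimately have "\<gamma> 1 \<in> D" by (rule closed_covers_curve[OF C(1) D(1) \<gamma>(1)])
    then show False using \<gamma> ab D by blast
  qed
  moreover have "S \<noteq> {}" using subgroup.one_closed[OF S] by blast
  ultimately show ?thesis unfolding irreducible_space_def top by blast
qed

lemma connected_if_irreducible: "irreducible_space T \<Longrightarrow> connected_space T"
  unfolding irreducible_space_def connected_space_closedin_eq by blast

lemma curve_connected_comp:
  assumes S: "subgroup S Aut_comm" and "curve_connected S g" "curve_connected S h"
  shows "curve_connected S (g \<circ> h)"
proof -
  obtain \<gamma> \<delta> where "entire_curve \<gamma>" "range \<gamma> \<subseteq> S" "\<gamma> 0 = id" "\<gamma> 1 = g"
    and "entire_curve \<delta>" "range \<delta> \<subseteq> S" "\<delta> 0 = id" "\<delta> 1 = h"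
    using assms(2,3) unfolding curve_connected_def by blast
  moreover have "\<gamma> t \<circ> \<delta> t \<in> S" if "\<gamma> t \<in> S" "\<delta> t \<in> S" for t
    using subgroup.m_closed[OF S that] by (simp add: Aut_comm_simps)
  ultimately show ?thesis
    unfolding curve_connected_def
    by (intro exI[of _ "\<lambda>t. \<gamma> t \<circ> \<delta> t"]) (auto intro!: entire_curve_comp)
qed

section \<open>Curves in the affine group\<close>

text \<open>For \<open>p \<noteq> 0\<close> the entry \<open>p = exp w\<close> moves along \<open>exp (t w)\<close>, the entries off the diagonal are scaled
  by \<open>t\<close>, and the determinant dictates the last entry, which is entire because the exponential
  has no zeros. For \<open>p = 0\<close> the path is a rotation, with terms added that account for \<open>s\<close>. The last
  conclusion says that the path of a diagonal matrix stays in the torus.\<close>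

lemma SL2_entire_path:
  fixes p q r s :: complex
  assumes det: "p * s - q * r = 1"
  obtains P Q R S where
    "P holomorphic_on UNIV" "Q holomorphic_on UNIV" "R holomorphic_on UNIV" "S holomorphic_on UNIV"
    "\<And>t. P t * S t - Q t * R t = 1"
    "P 0 = 1" "Q 0 = 0" "R 0 = 0" "S 0 = 1" "P 1 = p" "Q 1 = q" "R 1 = r" "S 1 = s"
    "\<And>t. q = 0 \<Longrightarrow> r = 0 \<Longrightarrow> Q t = 0 \<and> R t = 0"
proof (cases "p = 0")
  case False
  then obtain w where w: "p = exp w" by (metis exp_Ln)
  have s: "s = (1 + q * r) * exp (- w)"
    using det w by (simp add: exp_minus field_simps)
  show ?thesis
  proof (rule that[of "\<lambda>t. exp (t * w)" "\<lambda>t. t * q" "\<lambda>t. t * r" "\<lambda>t. (1 + t^2 * q * r) * exp (- (t * w))"])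
    show "exp (t * w) * ((1 + t\<^sup>2 * q * r) * exp (- (t * w))) - t * q * (t * r) = 1" for t
      by (simp add: exp_minus field_simps power2_eq_square)
  qed (auto intro!: holomorphic_intros simp: w s)
next
  case True
  have "q * r = p * s - 1" using det by (simp add: algebra_simps)
  then have qr: "q * r = - 1" using True by simp
  \<comment> \<open>The coefficients of the matrix entries below are chosen so that the terms with \<open>s\<close> cancel in the
    determinant, using \<open>q r = - 1\<close>.\<close>
  define c where "c t = cos (pi / 2 * t)" for t :: complex
  define d where "d t = sin (pi / 2 * t)" for t :: complex
  have cd: "c t * c t = 1 - d t * d t" for t
    using sin_cos_squared_add[of "pi / 2 * t"] by (simp add: c_def d_def power2_eq_square algebra_simps)
  have hol: "c holomorphic_on UNIV" "d holomorphic_on UNIV"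
    unfolding c_def d_def by (auto intro!: holomorphic_intros)
  have half: "complex_of_real pi / 2 = complex_of_real (pi / 2)" by simp
  have v: "c 0 = 1" "d 0 = 0" "c 1 = 0" "d 1 = 1"
    by (simp_all add: c_def d_def half cos_of_real sin_of_real del: of_real_divide)
  show ?thesis
  proof (rule that[of c "\<lambda>t. q * d t - s * q * d t * c t" "\<lambda>t. r * d t" "\<lambda>t. s * d t * d t + c t"])
    show "c t * (s * d t * d t + c t) - (q * d t - s * q * d t * c t) * (r * d t) = 1" for t
    proof -
      have "c t * (s * d t * d t + c t) - (q * d t - s * q * d t * c t) * (r * d t) =
         c t * c t - q * r * d t * d t + s * d t * d t * c t * (1 + q * r)"
        by (simp add: algebra_simps)
      then show ?thesis by (simp add: qr cd)
    qed
  qed (use qr in \<open>auto intro!: holomorphic_intros hol simp: v True\<close>)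
qed

section \<open>Contraction of an automorphism to its affine part\<close>

text \<open>The subtraction of natural numbers is truncated on purpose: the exponent of \<open>t\<close> is \<open>0\<close> for the
  empty word, as it is for words of length one, so constant terms stay fixed.\<close>

definition contract :: "complex \<Rightarrow> free_alg \<Rightarrow> free_alg" where
  "contract t p = (\<Sum>w \<in> Poly_Mapping.keys p.
     Poly_Mapping.single w (Poly_Mapping.lookup p w * t ^ (length (letters w) - 1)))"

lemma entire_family_contract: "entire_family (\<lambda>t. contract t p)"
  unfolding contract_def
  by (intro entire_family_sum entire_family.single holomorphic_intros)

lemma contract_add: "contract t (p + q) = contract t p + contract t q"
  unfolding contract_def
  by (intro setsum_keys_plus_distrib) (simp_all add: distrib_right single_add)

lemma contract_single:
  "contract t (Poly_Mapping.single w c) = Poly_Mapping.single w (c * t ^ (length (letters w) - 1))"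
  by (simp add: contract_def)

lemma contract_1: "contract 1 p = p"
  by (induction p rule: free_alg_single_induct) (simp_all add: contract_add contract_single)

abbreviation affine_part :: "free_alg \<Rightarrow> free_alg" where
  "affine_part p \<equiv> affine (Poly_Mapping.lookup p 0) (Poly_Mapping.lookup p (Word [Lx]))
     (Poly_Mapping.lookup p (Word [Ly]))"

lemma affine_eq_single:
  "affine a p q = Poly_Mapping.single 0 a + Poly_Mapping.single (Word [Lx]) p
     + Poly_Mapping.single (Word [Ly]) q"
  by (simp add: affine_def scalar_def gen_x_def gen_y_def mult_single)

lemma lookup_affine:
  "Poly_Mapping.lookup (affine a p q) 0 = a"
  "Poly_Mapping.lookup (affine a p q) (Word [Lx]) = p"
  "Poly_Mapping.lookup (affine a p q) (Word [Ly]) = q"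
  by (simp_all add: affine_eq_single lookup_add lookup_single zero_nc_word_def)

lemma contract_0: "contract 0 p = affine_part p"
proof (induction p rule: free_alg_single_induct)
  case (single w c)
  consider "w = 0" | "w = Word [Lx]" | "w = Word [Ly]" | "length (letters w) \<ge> 2"
  proof (cases w)
    case (Word l)
    show ?thesis
    proof (cases l)
      case (Cons a l')
      then show ?thesis using Word that by (cases a; cases l') auto
    qed (use Word that in \<open>auto simp: zero_nc_word_def\<close>)
  qed
  then show ?case
  proof cases
    case 4
    then have "w \<noteq> 0" "w \<noteq> Word [Lx]" "w \<noteq> Word [Ly]" by (auto simp: zero_nc_word_def)
    with 4 show ?thesis
      by (simp add: contract_single affine_eq_single lookup_single zero_power)
  qed (simp_all add: contract_single affine_eq_single lookup_single zero_nc_word_def)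
next
  case (add p q)
  then show ?case
    by (simp add: contract_add affine_eq_single lookup_add single_add add_ac)
qed

abbreviation dilation :: "complex \<Rightarrow> free_alg \<Rightarrow> free_alg" where
  "dilation t \<equiv> affine_map 0 t 0 0 0 t"

lemma dilation_single:
  "dilation t (Poly_Mapping.single w c) = Poly_Mapping.single w (c * t ^ length (letters w))"
proof -
  have "word_image (scalar t * gen_x) (scalar t * gen_y) l =
      Poly_Mapping.single (Word l) (t ^ length l)" for l
    by (induction l)
      (auto simp: scalar_def gen_x_def gen_y_def mult_single plus_nc_word_def zero_nc_word_def
        split: letter.split simp flip: single_one)
  then show ?thesis
    by (simp add: affine_map_def affine_def scalar_simps subst_alg_single)
      (simp add: scalar_def mult_single)
qed

text \<open>Away from \<open>t = 0\<close>, contracting is dilating and dividing by \<open>t\<close>, up to restoring the constant term.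
  This exhibits the contraction of an automorphism as a composition of automorphisms.\<close>

lemma contract_dilation:
  assumes "t \<noteq> 0"
  shows "contract t p = affine ((1 - 1/t) * Poly_Mapping.lookup p 0) 0 0 + scalar (1/t) * dilation t p"
proof (induction p rule: free_alg_single_induct)
  case (single w c)
  obtain l where w: "w = Word l" by (cases w)
  show ?case
    using assms
    by (cases l)
      (simp_all add: w contract_single dilation_single affine_eq_single scalar_def mult_single
        lookup_single zero_nc_word_def plus_nc_word_def field_simps flip: single_add)
next
  case (add p q)
  then show ?case
    by (simp add: contract_add lookup_add affine_eq_single single_add distrib_left
        alg_homD(1)[OF alg_hom_affine_map] add_ac)
qed

definition contraction :: "(free_alg \<Rightarrow> free_alg) \<Rightarrow> complex \<Rightarrow> free_alg \<Rightarrow> free_alg" where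
  "contraction \<sigma> t = subst_alg (contract t (\<sigma> gen_x)) (contract t (\<sigma> gen_y))"

lemma entire_curve_contraction: "entire_curve (contraction \<sigma>)"
  by (simp add: entire_curve_def contraction_def alg_hom_subst_alg subst_alg_gens
      entire_family_contract)

lemma contraction_1: "alg_hom \<sigma> \<Longrightarrow> contraction \<sigma> 1 = \<sigma>"
  by (simp add: contraction_def contract_1 flip: alg_hom_eq_subst_alg)

lemma contraction_0:
  "contraction \<sigma> 0 = affine_map
     (Poly_Mapping.lookup (\<sigma> gen_x) 0) (Poly_Mapping.lookup (\<sigma> gen_x) (Word [Lx]))
     (Poly_Mapping.lookup (\<sigma> gen_x) (Word [Ly]))
     (Poly_Mapping.lookup (\<sigma> gen_y) 0) (Poly_Mapping.lookup (\<sigma> gen_y) (Word [Lx]))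
     (Poly_Mapping.lookup (\<sigma> gen_y) (Word [Ly]))"
  by (simp add: contraction_def contract_0 affine_map_def)

lemma bij_dilation:
  assumes "t \<noteq> 0"
  shows "bij (dilation t)"
proof (rule o_bij)
  show "dilation (1/t) \<circ> dilation t = id" "dilation t \<circ> dilation (1/t) = id"
    using assms by (simp_all add: affine_map_comp affine_map_id)
qed

text \<open>Only the three ways to split a word of length two contribute. In a commutator the terms that
  contain a constant coefficient cancel, which leaves the determinant of the linear parts.\<close>

lemma lookup_mult_length_2:
  fixes p q :: free_alg
  shows "Poly_Mapping.lookup (p * q) (Word [a, b]) =
     Poly_Mapping.lookup p 0 * Poly_Mapping.lookup q (Word [a, b]) +
     Poly_Mapping.lookup p (Word [a]) * Poly_Mapping.lookup q (Word [b]) +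
     Poly_Mapping.lookup p (Word [a, b]) * Poly_Mapping.lookup q 0"
proof (induction p rule: free_alg_single_induct)
  case (single w c)
  show ?case
  proof (induction q rule: free_alg_single_induct)
    case (single w' c')
    obtain l l' where "w = Word l" "w' = Word l'" by (cases w, cases w')
    moreover have "l @ l' = [a, b] \<longleftrightarrow>
        l = [] \<and> l' = [a, b] \<or> l = [a] \<and> l' = [b] \<or> l = [a, b] \<and> l' = []"
      by (auto simp: append_eq_Cons_conv)
    ultimately show ?case
      by (simp add: mult_single lookup_single plus_nc_word_def zero_nc_word_def when_def)
  qed (simp add: distrib_left lookup_add algebra_simps)
qed (simp add: distrib_right lookup_add algebra_simps)

lemma affine_part_det:
  assumes "\<sigma> \<in> carrier Aut_comm"
  shows "Poly_Mapping.lookup (\<sigma> gen_x) (Word [Lx]) * Poly_Mapping.lookup (\<sigma> gen_y) (Word [Ly]) -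
     Poly_Mapping.lookup (\<sigma> gen_x) (Word [Ly]) * Poly_Mapping.lookup (\<sigma> gen_y) (Word [Lx]) = 1"
proof -
  have "Poly_Mapping.lookup (commutator (\<sigma> gen_x) (\<sigma> gen_y)) (Word [Lx, Ly]) =
      Poly_Mapping.lookup (commutator gen_x gen_y) (Word [Lx, Ly])"
    using assms by (simp add: carrier_Aut_comm_iff)
  then show ?thesis
    by (simp add: commutator_def lookup_minus lookup_mult_length_2 gen_x_def gen_y_def
        lookup_single zero_nc_word_def algebra_simps)
qed

text \<open>For \<open>t \<noteq> 0\<close> the contraction is \<open>\<delta> \<circ> \<sigma> \<circ> \<kappa>\<close> with \<open>\<delta>\<close> the dilation by \<open>t\<close> and \<open>\<kappa>\<close> the dilation by
  \<open>1/t\<close> composed with a translation that restores the constant terms; the factors \<open>t\<^sup>2\<close> and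
  \<open>1/t\<^sup>2\<close> that the dilations contribute to the commutator cancel. At \<open>t = 0\<close> this formula breaks
  down, but there the contraction is affine of determinant one.\<close>

lemma contraction_in_Aut_comm:
  assumes "\<sigma> \<in> carrier Aut_comm"
  shows "contraction \<sigma> t \<in> carrier Aut_comm"
proof (cases "t = 0")
  case True
  then show ?thesis
    by (simp add: contraction_0 affine_map_in_Aut_comm affine_part_det[OF assms])
next
  case False
  have \<sigma>: "bij \<sigma>" "alg_hom \<sigma>" and comm: "commutator (\<sigma> gen_x) (\<sigma> gen_y) = commutator gen_x gen_y"
    using assms by (auto simp: carrier_Aut_comm_iff)
  define a where "a = (1 - 1/t) * Poly_Mapping.lookup (\<sigma> gen_x) 0"
  define b where "b = (1 - 1/t) * Poly_Mapping.lookup (\<sigma> gen_y) 0"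
  define \<kappa> where "\<kappa> = affine_map a (1/t) 0 b 0 (1/t)"
  define \<phi> where "\<phi> = dilation t \<circ> \<sigma>"
  have "\<kappa> = dilation (1/t) \<circ> affine_map a 1 0 b 0 1"
    by (simp add: \<kappa>_def affine_map_comp)
  moreover have "bij (affine_map a 1 0 b 0 1)"
    using affine_map_in_Aut_comm[of 1 1 0 0 a b] by (simp add: carrier_Aut_comm_iff)
  ultimately have \<kappa>: "bij \<kappa>" "alg_hom \<kappa>"
    using bij_dilation[of "1/t"] False
    by (auto intro!: bij_comp alg_hom_comp alg_hom_affine_map)
  have \<phi>: "bij \<phi>" "alg_hom \<phi>"
    unfolding \<phi>_def using \<sigma> bij_dilation[OF False]
    by (auto intro: bij_comp alg_hom_comp alg_hom_affine_map)
  have eq: "contraction \<sigma> t = \<phi> \<circ> \<kappa>"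
  proof (rule alg_hom_eqI)
    show "contraction \<sigma> t gen_x = (\<phi> \<circ> \<kappa>) gen_x" "contraction \<sigma> t gen_y = (\<phi> \<circ> \<kappa>) gen_y"
      using False
      by (simp_all add: contraction_def subst_alg_gens contract_dilation \<kappa>_def affine_map_gens
          alg_hom_affine[OF \<phi>(2)] a_def b_def) (simp_all add: affine_def \<phi>_def scalar_simps)
  qed (simp_all add: contraction_def alg_hom_subst_alg alg_hom_comp \<phi> \<kappa>)
  have "\<phi> (commutator gen_x gen_y) = scalar (t * t) * commutator gen_x gen_y"
    using comm by (simp add: \<phi>_def alg_homD[OF \<sigma>(2)] alg_homD[OF alg_hom_affine_map]
        affine_map_gens commutator_affine)
  moreover have "commutator (\<kappa> gen_x) (\<kappa> gen_y) = scalar (1/t * (1/t)) * commutator gen_x gen_y"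
    by (simp add: \<kappa>_def affine_map_gens commutator_affine)
  then have "commutator (\<phi> (\<kappa> gen_x)) (\<phi> (\<kappa> gen_y)) =
      scalar (1/t * (1/t)) * \<phi> (commutator gen_x gen_y)"
    by (metis alg_homD(2,3,6)[OF \<phi>(2)])
  ultimately have "commutator (\<phi> (\<kappa> gen_x)) (\<phi> (\<kappa> gen_y)) = commutator gen_x gen_y"
    using False by (simp add: scalar_mult_mult scalar_simps(2))
  then show ?thesis
    unfolding eq carrier_Aut_comm_iff using \<phi> \<kappa> by (simp add: bij_comp alg_hom_comp)
qed

section \<open>Evaluation on matrices and the stabilizers\<close>

abbreviation pair_carrier :: "nat \<Rightarrow> mat_pair set" where
  "pair_carrier n \<equiv> carrier_mat n n \<times> carrier_mat n n"

lemma word_eval_carrier: "v \<in> pair_carrier n \<Longrightarrow> word_eval n v w \<in> carrier_mat n n"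
  by (induction w) (auto split: letter.split)

lemma word_eval_append:
  assumes "v \<in> pair_carrier n"
  shows "word_eval n v (w @ w') = word_eval n v w * word_eval n v w'"
proof (induction w)
  case Nil
  show ?case by (simp add: left_mult_one_mat[OF word_eval_carrier[OF assms]])
next
  case (Cons a w)
  have "(case a of Lx \<Rightarrow> fst v | Ly \<Rightarrow> snd v) \<in> carrier_mat n n"
    using assms by (auto split: letter.split)
  then show ?case
    using Cons word_eval_carrier[OF assms] by (simp add: assoc_mult_mat[of _ n n _ n _ n])
qed

lemma subst_mat_carrier: "subst_mat n v p \<in> carrier_mat n n"
  by (simp add: subst_mat_def)

lemma subst_mat_index:
  "i < n \<Longrightarrow> j < n \<Longrightarrow> subst_mat n v p $$ (i, j) =
     (\<Sum>w \<in> Poly_Mapping.keys p. Poly_Mapping.lookup p w * (word_eval n v (letters w) $$ (i, j)))"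
  by (simp add: subst_mat_def)

lemma subst_mat_add: "subst_mat n v (p + q) = subst_mat n v p + subst_mat n v q"
proof (rule eq_matI)
  fix i j assume "i < dim_row (subst_mat n v p + subst_mat n v q)"
    "j < dim_col (subst_mat n v p + subst_mat n v q)"
  then have ij: "i < n" "j < n" by (simp_all add: subst_mat_def)
  have "subst_mat n v (p + q) $$ (i, j) = subst_mat n v p $$ (i, j) + subst_mat n v q $$ (i, j)"
    unfolding subst_mat_index[OF ij]
    by (rule setsum_keys_plus_distrib) (simp_all add: distrib_right)
  then show "subst_mat n v (p + q) $$ (i, j) = (subst_mat n v p + subst_mat n v q) $$ (i, j)"
    using ij by (simp add: subst_mat_def)
qed (simp_all add: subst_mat_def)

lemma subst_mat_single:
  assumes "v \<in> pair_carrier n"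
  shows "subst_mat n v (Poly_Mapping.single w c) = c \<cdot>\<^sub>m word_eval n v (letters w)"
  using word_eval_carrier[OF assms, of "letters w"]
  by (intro eq_matI) (auto simp: subst_mat_def)

lemma subst_mat_mult:
  assumes v: "v \<in> pair_carrier n"
  shows "subst_mat n v (p * q) = subst_mat n v p * subst_mat n v q"
proof (induction p rule: free_alg_single_induct)
  case (single w c)
  show ?case
  proof (induction q rule: free_alg_single_induct)
    case (single w' c')
    have smult: "k \<cdot>\<^sub>m (l \<cdot>\<^sub>m A) = l * k \<cdot>\<^sub>m A" for k l :: complex and A
      by (intro eq_matI) auto
    have "c \<cdot>\<^sub>m word_eval n v (letters w) * (c' \<cdot>\<^sub>m word_eval n v (letters w')) =
        c * c' \<cdot>\<^sub>m (word_eval n v (letters w) * word_eval n v (letters w'))"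
      using word_eval_carrier[OF v]
      by (simp add: mult_smult_assoc_mat[of _ n n _ n] mult_smult_distrib[of _ n n _ n] smult)
    then show ?case
      by (simp add: mult_single subst_mat_single[OF v] plus_nc_word_def word_eval_append[OF v])
  next
    case (add p q)
    then show ?case
      by (simp add: distrib_left subst_mat_add
          mult_add_distrib_mat[OF subst_mat_carrier subst_mat_carrier subst_mat_carrier])
  qed
next
  case (add p q)
  then show ?case
    by (simp add: distrib_right subst_mat_add
        add_mult_distrib_mat[OF subst_mat_carrier subst_mat_carrier subst_mat_carrier])
qed

lemma subst_mat_scalar:
  assumes "v \<in> pair_carrier n"
  shows "subst_mat n v (scalar c) = c \<cdot>\<^sub>m 1\<^sub>m n"
  by (simp add: scalar_def subst_mat_single[OF assms] zero_nc_word_def)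

lemma subst_mat_gens:
  assumes "v \<in> pair_carrier n"
  shows "subst_mat n v gen_x = fst v" "subst_mat n v gen_y = snd v"
proof -
  have "1 \<cdot>\<^sub>m A = A" for A :: "complex mat" by (intro eq_matI) auto
  moreover have "fst v \<in> carrier_mat n n" "snd v \<in> carrier_mat n n" using assms by auto
  ultimately show "subst_mat n v gen_x = fst v" "subst_mat n v gen_y = snd v"
    by (simp_all add: gen_x_def gen_y_def subst_mat_single[OF assms])
qed

lemma subst_mat_diff: "subst_mat n v (p - q) = subst_mat n v p - subst_mat n v q"
proof -
  have "subst_mat n v p = subst_mat n v (p - q) + subst_mat n v q"
    by (simp flip: subst_mat_add)
  then show ?thesis
    by (intro eq_matI) (simp_all add: subst_mat_def)
qed

lemma subst_mat_commutator:
  assumes "v \<in> pair_carrier n"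
  shows "subst_mat n v (commutator p q) =
     subst_mat n v p * subst_mat n v q - subst_mat n v q * subst_mat n v p"
  by (simp add: commutator_def subst_mat_diff subst_mat_mult[OF assms])

definition image_pair :: "nat \<Rightarrow> mat_pair \<Rightarrow> (free_alg \<Rightarrow> free_alg) \<Rightarrow> mat_pair" where
  "image_pair n v \<phi> = (subst_mat n v (\<phi> gen_x), subst_mat n v (\<phi> gen_y))"

lemma image_pair_carrier: "image_pair n v \<phi> \<in> pair_carrier n"
  by (simp add: image_pair_def subst_mat_carrier)

text \<open>Evaluating \<open>\<phi>(p)\<close> at a pair of matrices is evaluating \<open>p\<close> at the image of the pair. This makes
  evaluation an action and is used to transport the condition on the base point between an
  automorphism and its inverse.\<close>

lemma subst_mat_alg_hom:
  assumes "alg_hom \<phi>" "v \<in> pair_carrier n"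
  shows "subst_mat n v (\<phi> p) = subst_mat n (image_pair n v \<phi>) p"
  by (induction p rule: free_alg_induct)
    (simp_all add: alg_homD[OF assms(1)] subst_mat_scalar[OF assms(2)] subst_mat_add
      subst_mat_scalar[OF image_pair_carrier] subst_mat_gens[OF image_pair_carrier]
      subst_mat_mult[OF assms(2)] subst_mat_mult[OF image_pair_carrier],
     simp_all add: image_pair_def)

lemma image_pair_comp:
  assumes "alg_hom \<phi>" "v \<in> pair_carrier n"
  shows "image_pair n v (\<phi> \<circ> \<psi>) = image_pair n (image_pair n v \<phi>) \<psi>"
  by (simp add: image_pair_def[of _ _ \<psi>] image_pair_def[of _ _ "\<phi> \<circ> \<psi>"]
      subst_mat_alg_hom[OF assms])

lemma image_pair_id: "v \<in> pair_carrier n \<Longrightarrow> image_pair n v id = v"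
  by (simp add: image_pair_def subst_mat_gens)

lemma similar_mat_wit_add_mult:
  assumes "similar_mat_wit A A' P Q" "similar_mat_wit B B' P Q" "A \<in> carrier_mat n n"
    "B \<in> carrier_mat n n"
  shows "similar_mat_wit (A + B) (A' + B') P Q" "similar_mat_wit (A * B) (A' * B') P Q"
proof -
  have c: "P \<in> carrier_mat n n" "Q \<in> carrier_mat n n" "A' \<in> carrier_mat n n" "B' \<in> carrier_mat n n"
    and pq: "P * Q = 1\<^sub>m n" "Q * P = 1\<^sub>m n" and ab: "A = P * A' * Q" "B = P * B' * Q"
    using similar_mat_witD2[OF assms(3,1)] similar_mat_witD2[OF assms(4,2)] by auto
  show "similar_mat_wit (A + B) (A' + B') P Q"
  proof (rule similar_mat_witI[OF pq])
    show "A + B = P * (A' + B') * Q"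
      using c by (simp add: ab mult_add_distrib_mat[of _ n n _ n] add_mult_distrib_mat[of _ n n _ _ n])
  qed (use c assms(3,4) in auto)
  show "similar_mat_wit (A * B) (A' * B') P Q"
  proof (rule similar_mat_witI[OF pq])
    have "A * B = P * (A' * ((Q * P) * (B' * Q)))"
      unfolding ab using c by (simp add: assoc_mult_mat[of _ n n _ n _ n])
    also have "\<dots> = P * (A' * B') * Q"
      unfolding pq using c by (simp add: assoc_mult_mat[of _ n n _ n _ n])
    finally show "A * B = P * (A' * B') * Q" .
  qed (use c assms(3,4) in auto)
qed

lemma subst_mat_similar:
  assumes "similar_mat_wit X X' P Q" "similar_mat_wit Y Y' P Q"
    "X \<in> carrier_mat n n" "Y \<in> carrier_mat n n"
  shows "similar_mat_wit (subst_mat n (X, Y) p) (subst_mat n (X', Y') p) P Q"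
proof -
  have c: "P \<in> carrier_mat n n" "Q \<in> carrier_mat n n" "X' \<in> carrier_mat n n" "Y' \<in> carrier_mat n n"
    and pq: "P * Q = 1\<^sub>m n" "Q * P = 1\<^sub>m n"
    using similar_mat_witD2[OF assms(3,1)] similar_mat_witD2[OF assms(4,2)] by auto
  have v: "(X, Y) \<in> pair_carrier n" "(X', Y') \<in> pair_carrier n" using assms c by auto
  show ?thesis
  proof (induction p rule: free_alg_induct)
    case (scalar k)
    show ?case unfolding subst_mat_scalar[OF v(1)] subst_mat_scalar[OF v(2)]
    proof (rule similar_mat_witI[OF pq])
      show "k \<cdot>\<^sub>m 1\<^sub>m n = P * (k \<cdot>\<^sub>m 1\<^sub>m n) * Q"
        using c pq by (simp add: mult_smult_distrib[of _ n n _ n] mult_smult_assoc_mat[of _ n n _ n])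
    qed (use c in auto)
  next
    case (add p q)
    then show ?case unfolding subst_mat_add
      by (intro similar_mat_wit_add_mult(1)) (auto intro: subst_mat_carrier)
  next
    case (mult p q)
    then show ?case unfolding subst_mat_mult[OF v(1)] subst_mat_mult[OF v(2)]
      by (intro similar_mat_wit_add_mult(2)) (auto intro: subst_mat_carrier)
  qed (use assms in \<open>simp_all add: subst_mat_gens[OF v(1)] subst_mat_gens[OF v(2)]\<close>)
qed

lemma CM_pairs_carrier: "v \<in> CM_pairs n \<Longrightarrow> v \<in> pair_carrier n"
  by (auto simp: CM_pairs_def)

text \<open>An automorphism that fixes \<open>[x, y]\<close> preserves the commutator of every pair of matrices exactly, not
  merely up to conjugation. For matrices of size two this determines the image of the base point
  up to an affine map.\<close>

lemma commutator_image_pair: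
  assumes "\<sigma> \<in> carrier Aut_comm" "v \<in> pair_carrier n"
  shows "fst (image_pair n v \<sigma>) * snd (image_pair n v \<sigma>) - snd (image_pair n v \<sigma>) * fst (image_pair n v \<sigma>)
     = fst v * snd v - snd v * fst v"
  using assms(1) unfolding carrier_Aut_comm_iff image_pair_def
  by (simp add: subst_mat_gens[OF assms(2)] flip: subst_mat_commutator[OF assms(2)])
    (simp add: subst_mat_commutator[OF assms(2)] subst_mat_gens[OF assms(2)])

lemma image_pair_CM_pairs:
  assumes "\<sigma> \<in> carrier Aut_comm" "v \<in> CM_pairs n"
  shows "image_pair n v \<sigma> \<in> CM_pairs n"
  using commutator_image_pair[OF assms(1) CM_pairs_carrier[OF assms(2)]] assms(2)
  by (auto simp: CM_pairs_def case_prod_beta image_pair_def subst_mat_carrier)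

lemma image_pair_CM_rel:
  assumes "\<sigma> \<in> carrier Aut_comm" "(v, w) \<in> CM_rel n"
  shows "(image_pair n v \<sigma>, image_pair n w \<sigma>) \<in> CM_rel n"
proof -
  obtain X Y X' Y' P Q where vw: "v = (X, Y)" "w = (X', Y')" "v \<in> CM_pairs n" "w \<in> CM_pairs n"
    and sim: "similar_mat_wit X' X P Q" "similar_mat_wit Y' Y P Q"
    using assms(2) by (auto simp: CM_rel_def)
  have c: "X' \<in> carrier_mat n n" "Y' \<in> carrier_mat n n"
    using CM_pairs_carrier[OF vw(4)] vw(2) by auto
  have "image_pair n v \<sigma> \<in> CM_pairs n" "image_pair n w \<sigma> \<in> CM_pairs n"
    using vw assms(1) image_pair_CM_pairs by auto
  then show ?thesis
    using subst_mat_similar[OF sim c] unfolding CM_rel_def image_pair_def vw(1,2) by auto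
qed

abbreviation base_pair :: "nat \<Rightarrow> mat_pair" where
  "base_pair n \<equiv> (CM_X0 n, CM_Y0 n)"

lemma base_carrier [simp]: "CM_X0 n \<in> carrier_mat n n" "CM_Y0 n \<in> carrier_mat n n"
  by (simp_all add: CM_X0_def CM_Y0_def)

lemma base_pair_carrier: "base_pair n \<in> pair_carrier n"
  by simp

lemma base_pair_CM_pairs:
  assumes "1 \<le> n"
  shows "base_pair n \<in> CM_pairs n"
proof -
  have "CM_base n \<noteq> {}"
    using CM_base_in_CM_space[OF assms] in_quotient_imp_non_empty[OF equiv_CM_rel]
    unfolding CM_space_def by blast
  then show ?thesis unfolding CM_base_def CM_rel_def by auto
qed

text \<open>The action is by inverse automorphisms and on conjugacy classes. As evaluation respects conjugation,
  a single representative decides; applying \<open>\<sigma>\<close> to both sides then replaces the inverse of \<open>\<sigma>\<close>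
  by \<open>\<sigma>\<close> itself.\<close>

lemma G_stab_iff:
  assumes n: "1 \<le> n"
  shows "\<sigma> \<in> G_stab n \<longleftrightarrow>
     \<sigma> \<in> carrier Aut_comm \<and> (base_pair n, image_pair n (base_pair n) \<sigma>) \<in> CM_rel n"
proof -
  let ?b = "base_pair n"
  have b: "?b \<in> CM_pairs n" by (rule base_pair_CM_pairs[OF n])
  have "act_CM n \<sigma> (CM_base n) = CM_base n \<longleftrightarrow> (?b, image_pair n ?b \<sigma>) \<in> CM_rel n"
    if \<sigma>: "\<sigma> \<in> carrier Aut_comm"
  proof -
    define \<tau> where "\<tau> = inv_into UNIV \<sigma>"
    have \<tau>: "\<tau> \<in> carrier Aut_comm" using inv_Aut_comm(2)[OF \<sigma>] by (simp add: \<tau>_def)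
    have hom: "alg_hom \<sigma>" "alg_hom \<tau>" "bij \<sigma>" using \<sigma> \<tau> by (auto simp: carrier_Aut_comm_iff)
    have inv: "\<sigma> \<circ> \<tau> = id" "\<tau> \<circ> \<sigma> = id"
      using hom(3) by (auto simp: \<tau>_def bij_def surj_iff)
    have act: "act_pair n \<sigma> v = image_pair n v \<tau>" for v
      by (simp add: act_pair_def image_pair_def \<tau>_def)
    have cls: "CM_rel n `` {act_pair n \<sigma> v} = CM_rel n `` {image_pair n ?b \<tau>}"
      if "v \<in> CM_base n" for v
      unfolding act using that image_pair_CM_rel[OF \<tau>, of ?b v n]
      by (metis CM_base_def Image_singleton_iff equiv_CM_rel equiv_class_eq)
    have "?b \<in> CM_base n"
      unfolding CM_base_def by (rule equiv_class_self[OF equiv_CM_rel b])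
    then have "act_CM n \<sigma> (CM_base n) = CM_rel n `` {image_pair n ?b \<tau>}"
      unfolding act_CM_def using cls by blast
    then have "act_CM n \<sigma> (CM_base n) = CM_base n \<longleftrightarrow> (image_pair n ?b \<tau>, ?b) \<in> CM_rel n"
      unfolding CM_base_def
      using eq_equiv_class_iff[OF equiv_CM_rel image_pair_CM_pairs[OF \<tau> b] b] by simp
    also have "\<dots> \<longleftrightarrow> (?b, image_pair n ?b \<sigma>) \<in> CM_rel n"
    proof
      assume "(image_pair n ?b \<tau>, ?b) \<in> CM_rel n"
      from image_pair_CM_rel[OF \<sigma> this] show "(?b, image_pair n ?b \<sigma>) \<in> CM_rel n"
        by (simp add: inv image_pair_id base_pair_carrier
            flip: image_pair_comp[OF hom(2) base_pair_carrier])
    next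
      assume "(?b, image_pair n ?b \<sigma>) \<in> CM_rel n"
      from image_pair_CM_rel[OF \<tau> this] show "(image_pair n ?b \<tau>, ?b) \<in> CM_rel n"
        by (simp add: inv image_pair_id base_pair_carrier
            flip: image_pair_comp[OF hom(1) base_pair_carrier])
    qed
    finally show ?thesis .
  qed
  then show ?thesis using n by (auto simp: G_stab_def stabilizer_def)
qed

lemma subgroup_G_stab: "subgroup (G_stab n) Aut_comm"
proof (cases "n = 0")
  interpret group Aut_comm by (rule group_Aut_comm)
  case True
  then show ?thesis by (simp add: G_stab_def subgroup_self)
next
  interpret group Aut_comm by (rule group_Aut_comm)
  case False
  then have n: "1 \<le> n" by simp
  note iff = G_stab_iff[OF n]
  let ?b = "base_pair n"
  have refl: "(?b, ?b) \<in> CM_rel n"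
    using equiv_CM_rel base_pair_CM_pairs[OF n] by (metis equiv_class_eq_iff)
  have tr: "(u, v) \<in> CM_rel n \<Longrightarrow> (v, w) \<in> CM_rel n \<Longrightarrow> (u, w) \<in> CM_rel n" for u v w
    using equiv_CM_rel by (meson equivE transD)
  have sy: "(u, v) \<in> CM_rel n \<Longrightarrow> (v, u) \<in> CM_rel n" for u v
    using equiv_CM_rel by (meson equivE symD)
  show ?thesis
  proof (rule subgroupI)
    show "G_stab n \<subseteq> carrier Aut_comm" by (auto simp: iff)
    have "id \<in> G_stab n"
      using one_closed refl by (simp add: iff Aut_comm_simps image_pair_id base_pair_carrier)
    then show "G_stab n \<noteq> {}" by blast
  next
    fix \<sigma> assume "\<sigma> \<in> G_stab n"
    then have \<sigma>: "\<sigma> \<in> carrier Aut_comm" and s: "(?b, image_pair n ?b \<sigma>) \<in> CM_rel n"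
      by (auto simp: iff)
    have i: "inv\<^bsub>Aut_comm\<^esub> \<sigma> \<in> carrier Aut_comm" using \<sigma> by simp
    have "\<sigma> \<circ> inv\<^bsub>Aut_comm\<^esub> \<sigma> = id" using r_inv[OF \<sigma>] by (simp add: Aut_comm_simps)
    then have "(image_pair n ?b (inv\<^bsub>Aut_comm\<^esub> \<sigma>), ?b) \<in> CM_rel n"
      using image_pair_CM_rel[OF i s] \<sigma>
      by (simp add: carrier_Aut_comm_iff image_pair_id base_pair_carrier
          flip: image_pair_comp[OF _ base_pair_carrier])
    then show "inv\<^bsub>Aut_comm\<^esub> \<sigma> \<in> G_stab n" using i sy by (simp add: iff)
  next
    fix \<sigma> \<tau> assume "\<sigma> \<in> G_stab n" "\<tau> \<in> G_stab n"
    then have \<sigma>: "\<sigma> \<in> carrier Aut_comm" "(?b, image_pair n ?b \<sigma>) \<in> CM_rel n"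
      and \<tau>: "\<tau> \<in> carrier Aut_comm" "(?b, image_pair n ?b \<tau>) \<in> CM_rel n"
      by (auto simp: iff)
    have "(?b, image_pair n ?b (\<sigma> \<circ> \<tau>)) \<in> CM_rel n"
      using tr[OF \<tau>(2) image_pair_CM_rel[OF \<tau>(1) \<sigma>(2)]] \<sigma>(1)
      by (simp add: carrier_Aut_comm_iff image_pair_comp[OF _ base_pair_carrier])
    then show "\<sigma> \<otimes>\<^bsub>Aut_comm\<^esub> \<tau> \<in> G_stab n"
      using m_closed[OF \<sigma>(1) \<tau>(1)] by (simp add: iff Aut_comm_simps)
  qed
qed

section \<open>The stabilizer for n = 1\<close>

text \<open>For \<open>n = 1\<close> both matrices of the base point vanish, so evaluation picks out the constant term.\<close>

lemma subst_mat_base_1: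
  "subst_mat 1 (base_pair 1) p = Poly_Mapping.lookup p 0 \<cdot>\<^sub>m 1\<^sub>m 1"
proof (induction p rule: free_alg_single_induct)
  case (single w c)
  have "word_eval 1 (base_pair 1) (a # l) = 0\<^sub>m 1 1" for a l
  proof -
    have "CM_X0 1 = 0\<^sub>m 1 1" "CM_Y0 1 = 0\<^sub>m 1 1"
      by (auto simp: CM_X0_def CM_Y0_def)
    then show ?thesis
      using word_eval_carrier[OF base_pair_carrier, of 1 l] by (cases a) simp_all
  qed
  moreover obtain l where "w = Word l" by (cases w)
  ultimately show ?case
    by (cases l)
      (auto simp: subst_mat_single[OF base_pair_carrier] lookup_single zero_nc_word_def
        simp del: word_eval.simps(2))
next
  case (add p q)
  then show ?case by (auto simp: subst_mat_add lookup_add)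
qed

lemma G_stab_1_iff:
  "\<sigma> \<in> G_stab 1 \<longleftrightarrow> \<sigma> \<in> carrier Aut_comm \<and>
     Poly_Mapping.lookup (\<sigma> gen_x) 0 = 0 \<and> Poly_Mapping.lookup (\<sigma> gen_y) 0 = 0"
proof -
  have z: "CM_X0 1 = 0\<^sub>m 1 1" "CM_Y0 1 = 0\<^sub>m 1 1"
    by (auto simp: CM_X0_def CM_Y0_def)
  have zero: "A = 0\<^sub>m 1 1" if "similar_mat_wit A (0\<^sub>m 1 1) P Q" "A \<in> carrier_mat 1 1"
    for A P Q :: "complex mat"
  proof -
    note w = similar_mat_witD2[OF that(2,1)]
    show ?thesis unfolding w(3) using w(6,7) by simp
  qed
  have smult: "c \<cdot>\<^sub>m 1\<^sub>m 1 = 0\<^sub>m 1 1 \<longleftrightarrow> c = 0" for c :: complex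
  proof
    assume "c \<cdot>\<^sub>m 1\<^sub>m 1 = 0\<^sub>m 1 1"
    then have "(c \<cdot>\<^sub>m 1\<^sub>m 1) $$ (0, 0) = 0\<^sub>m 1 1 $$ (0, 0)" by simp
    then show "c = 0" by simp
  qed auto
  have "(base_pair 1, v) \<in> CM_rel 1 \<longleftrightarrow> v = base_pair 1" for v
  proof
    assume "(base_pair 1, v) \<in> CM_rel 1"
    then show "v = base_pair 1" using zero unfolding CM_rel_def z CM_pairs_def by blast
  next
    assume "v = base_pair 1"
    then show "(base_pair 1, v) \<in> CM_rel 1"
      using equiv_CM_rel base_pair_CM_pairs[of 1] by (metis equiv_class_eq_iff order_refl)
  qed
  then show ?thesis
    by (simp only: G_stab_iff[OF order_refl] image_pair_def subst_mat_base_1[unfolded z] z smult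
        prod.inject)
qed

section \<open>The stabilizer for n = 2\<close>

text \<open>The combination \<open>a + p X\<^sub>0 + q Y\<^sub>0\<close> for \<open>n = 2\<close>; the sign comes from \<open>Y\<^sub>0 = - E\<close> with the matrix unit
  \<open>E\<close> in the upper right corner.\<close>

definition base_matrix :: "complex \<Rightarrow> complex \<Rightarrow> complex \<Rightarrow> complex mat" where
  "base_matrix a p q = Matrix.mat 2 2 (\<lambda>(i, j). if i = j then a else if i = 1 then p else - q)"

lemma base_matrix_index:
  "base_matrix a p q $$ (0, 0) = a" "base_matrix a p q $$ (0, Suc 0) = - q"
  "base_matrix a p q $$ (Suc 0, 0) = p" "base_matrix a p q $$ (Suc 0, Suc 0) = a"
  by (simp_all add: base_matrix_def)

lemma base_matrix_carrier [simp]: "base_matrix a p q \<in> carrier_mat 2 2"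
    and base_matrix_dim [simp]: "dim_row (base_matrix a p q) = 2" "dim_col (base_matrix a p q) = 2"
  by (simp_all add: base_matrix_def)

lemma eq_mat_2_iff:
  assumes "A \<in> carrier_mat 2 2" "B \<in> carrier_mat 2 2"
  shows "A = B \<longleftrightarrow> A $$ (0, 0) = B $$ (0, 0) \<and> A $$ (0, Suc 0) = B $$ (0, Suc 0) \<and>
     A $$ (Suc 0, 0) = B $$ (Suc 0, 0) \<and> A $$ (Suc 0, Suc 0) = B $$ (Suc 0, Suc 0)"
  using assms by (auto intro!: eq_matI simp: less_2_cases_iff)

lemma index_mult_mat_2:
  assumes "A \<in> carrier_mat 2 2" "B \<in> carrier_mat 2 2" "i < 2" "j < 2"
  shows "(A * B) $$ (i, j) = A $$ (i, 0) * B $$ (0, j) + A $$ (i, Suc 0) * B $$ (Suc 0, j)"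
  using assms by (simp add: scalar_prod_def numeral_2_eq_2)

lemma base_pair_2: "CM_X0 2 = base_matrix 0 1 0" "CM_Y0 2 = base_matrix 0 0 1"
  by (auto simp: CM_X0_def CM_Y0_def base_matrix_def less_2_cases_iff intro!: eq_matI)

lemma subst_mat_affine_2:
  "subst_mat 2 (base_pair 2) (affine a p q) = base_matrix a p q"
proof -
  have "subst_mat 2 (base_pair 2) (affine a p q) =
      a \<cdot>\<^sub>m 1\<^sub>m 2 + (p \<cdot>\<^sub>m 1\<^sub>m 2) * CM_X0 2 + (q \<cdot>\<^sub>m 1\<^sub>m 2) * CM_Y0 2"
    by (simp add: affine_def subst_mat_add subst_mat_mult[OF base_pair_carrier]
        subst_mat_scalar[OF base_pair_carrier] subst_mat_gens[OF base_pair_carrier])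
  then show ?thesis
    unfolding eq_mat_2_iff[OF subst_mat_carrier base_matrix_carrier]
    by (simp add: base_pair_2 base_matrix_index index_mult_mat_2 del: index_mult_mat(1))
qed

text \<open>The entries of \<open>[X, Y]\<close> off the diagonal vanish, which gives two homogeneous linear equations for the
  differences of the diagonal entries of \<open>X\<close> and \<open>Y\<close>. The determinant of this system is the upper
  left entry of \<open>[X, Y]\<close>, which is \<open>1\<close>. So the diagonals of \<open>X\<close> and \<open>Y\<close> are constant, and that
  entry says that the affine map with the coefficients read off from \<open>X\<close> and \<open>Y\<close> has determinant one.\<close>

lemma image_pair_2_affine:
  assumes \<sigma>: "\<sigma> \<in> carrier Aut_comm"
    and X: "X = subst_mat 2 (base_pair 2) (\<sigma> gen_x)" and Y: "Y = subst_mat 2 (base_pair 2) (\<sigma> gen_y)"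
  shows "X = base_matrix (X $$ (0, 0)) (X $$ (1, 0)) (- X $$ (0, 1))"
    and "Y = base_matrix (Y $$ (0, 0)) (Y $$ (1, 0)) (- Y $$ (0, 1))"
    and "X $$ (1, 0) * - Y $$ (0, 1) - - X $$ (0, 1) * Y $$ (1, 0) = 1"
proof -
  have c: "X \<in> carrier_mat 2 2" "Y \<in> carrier_mat 2 2" by (simp_all add: X Y subst_mat_carrier)
  have "X * Y - Y * X = CM_X0 2 * CM_Y0 2 - CM_Y0 2 * CM_X0 2"
    using commutator_image_pair[OF \<sigma> base_pair_carrier, of 2] by (simp add: image_pair_def X Y)
  then have e: "(X * Y - Y * X) $$ (i, j) = (CM_X0 2 * CM_Y0 2 - CM_Y0 2 * CM_X0 2) $$ (i, j)" for i j
    by simp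
  note idx = index_mult_mat_2 base_matrix_carrier base_pair_2 base_matrix_index c
  have e00: "X $$ (0, 1) * Y $$ (1, 0) - Y $$ (0, 1) * X $$ (1, 0) = 1"
    using e[of 0 0] c by (simp add: idx del: index_mult_mat(1))
  have e01: "(X $$ (0, 0) - X $$ (1, 1)) * Y $$ (0, 1) = (Y $$ (0, 0) - Y $$ (1, 1)) * X $$ (0, 1)"
    using e[of 0 1] c by (simp add: idx algebra_simps del: index_mult_mat(1))
  have e10: "(X $$ (0, 0) - X $$ (1, 1)) * Y $$ (1, 0) = (Y $$ (0, 0) - Y $$ (1, 1)) * X $$ (1, 0)"
    using e[of 1 0] c by (simp add: idx algebra_simps del: index_mult_mat(1))
  show "X $$ (1, 0) * - Y $$ (0, 1) - - X $$ (0, 1) * Y $$ (1, 0) = 1"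
    using e00 by (simp add: algebra_simps)
  have "X $$ (0, 0) - X $$ (1, 1) =
      (X $$ (0, 0) - X $$ (1, 1)) * (X $$ (0, 1) * Y $$ (1, 0) - Y $$ (0, 1) * X $$ (1, 0))"
    unfolding e00 by simp
  also have "\<dots> = X $$ (0, 1) * ((X $$ (0, 0) - X $$ (1, 1)) * Y $$ (1, 0)) -
      X $$ (1, 0) * ((X $$ (0, 0) - X $$ (1, 1)) * Y $$ (0, 1))"
    by (simp add: algebra_simps)
  also have "\<dots> = 0" unfolding e01 e10 by simp
  finally have x: "X $$ (1, 1) = X $$ (0, 0)" by simp
  have "Y $$ (0, 0) - Y $$ (1, 1) =
      (Y $$ (0, 0) - Y $$ (1, 1)) * (X $$ (0, 1) * Y $$ (1, 0) - Y $$ (0, 1) * X $$ (1, 0))"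
    unfolding e00 by simp
  also have "\<dots> = Y $$ (1, 0) * ((Y $$ (0, 0) - Y $$ (1, 1)) * X $$ (0, 1)) -
      Y $$ (0, 1) * ((Y $$ (0, 0) - Y $$ (1, 1)) * X $$ (1, 0))"
    by (simp add: algebra_simps)
  also have "\<dots> = 0" unfolding e01[symmetric] e10[symmetric] by simp
  finally have y: "Y $$ (1, 1) = Y $$ (0, 0)" by simp
  show "X = base_matrix (X $$ (0, 0)) (X $$ (1, 0)) (- X $$ (0, 1))"
    "Y = base_matrix (Y $$ (0, 0)) (Y $$ (1, 0)) (- Y $$ (0, 1))"
    using x y by (simp_all add: eq_mat_2_iff c base_matrix_carrier base_matrix_index)
qed

text \<open>The base point satisfies \<open>X\<^sup>2 = 0\<close>, \<open>Y\<^sup>2 = 0\<close> and \<open>X Y + Y X = - 1\<close>, and these relations are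
  invariant under conjugation. The first two give \<open>a = b = 0\<close>, \<open>p q = 0\<close> and \<open>r s = 0\<close>; the third,
  \<open>p s + q r = 1\<close>, excludes the solution \<open>p = s = 0\<close>. Conversely, a diagonal matrix conjugates
  \<open>(X\<^sub>0, Y\<^sub>0)\<close> to \<open>(p X\<^sub>0, s Y\<^sub>0)\<close> if \<open>p s = 1\<close>.\<close>

lemma conj_base_pair_2_iff:
  assumes det: "p * s - q * r = 1" and v: "(base_matrix a p q, base_matrix b r s) \<in> CM_pairs 2"
  shows "(base_pair 2, (base_matrix a p q, base_matrix b r s)) \<in> CM_rel 2 \<longleftrightarrow>
     a = 0 \<and> b = 0 \<and> q = 0 \<and> r = 0"
proof
  note idx = index_mult_mat_2 base_matrix_carrier base_matrix_index
  let ?X = "base_matrix a p q" and ?Y = "base_matrix b r s"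
  assume "(base_pair 2, (?X, ?Y)) \<in> CM_rel 2"
  then obtain P Q where sim: "similar_mat_wit ?X (CM_X0 2) P Q" "similar_mat_wit ?Y (CM_Y0 2) P Q"
    by (auto simp: CM_rel_def)
  have pq: "P \<in> carrier_mat 2 2" "Q \<in> carrier_mat 2 2" "P * Q = 1\<^sub>m 2"
    using similar_mat_witD2[OF base_matrix_carrier sim(1)] by auto
  have XX: "CM_X0 2 * CM_X0 2 = 0\<^sub>m 2 2"
    unfolding base_pair_2
    by (subst eq_mat_2_iff) (auto simp: idx simp del: index_mult_mat(1) intro!: carrier_matI)
  have YY: "CM_Y0 2 * CM_Y0 2 = 0\<^sub>m 2 2"
    unfolding base_pair_2
    by (subst eq_mat_2_iff) (auto simp: idx simp del: index_mult_mat(1) intro!: carrier_matI)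
  have XY: "CM_X0 2 * CM_Y0 2 + CM_Y0 2 * CM_X0 2 = (- 1) \<cdot>\<^sub>m 1\<^sub>m 2"
    unfolding base_pair_2
    by (subst eq_mat_2_iff) (auto simp: idx simp del: index_mult_mat(1) intro!: carrier_matI)
  have c: "?X \<in> carrier_mat 2 2" "?Y \<in> carrier_mat 2 2" by (rule base_matrix_carrier)+
  note mul = similar_mat_wit_add_mult(2)[of _ _ P Q _ _ 2]
  have "?X * ?X = P * (CM_X0 2 * CM_X0 2) * Q"
    using mul[OF sim(1) sim(1) c(1) c(1)] by (auto simp: similar_mat_wit_def Let_def)
  then have xx: "?X * ?X = 0\<^sub>m 2 2" using pq XX by simp
  have "?Y * ?Y = P * (CM_Y0 2 * CM_Y0 2) * Q"
    using mul[OF sim(2) sim(2) c(2) c(2)] by (auto simp: similar_mat_wit_def Let_def)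
  then have yy: "?Y * ?Y = 0\<^sub>m 2 2" using pq YY by simp
  have "similar_mat_wit (?X * ?Y + ?Y * ?X) (CM_X0 2 * CM_Y0 2 + CM_Y0 2 * CM_X0 2) P Q"
    using mul[OF sim c] mul[OF sim(2,1) c(2,1)] c
    by (intro similar_mat_wit_add_mult(1)[of _ _ _ _ _ _ 2]) auto
  then have "?X * ?Y + ?Y * ?X = P * ((- 1) \<cdot>\<^sub>m 1\<^sub>m 2) * Q"
    unfolding XY by (auto simp: similar_mat_wit_def Let_def)
  also have "\<dots> = (- 1) \<cdot>\<^sub>m 1\<^sub>m 2"
    using pq by (simp add: mult_smult_distrib[of _ 2 2 _ 2] mult_smult_assoc_mat[of _ 2 2 _ 2])
  finally have xy: "?X * ?Y + ?Y * ?X = (- 1) \<cdot>\<^sub>m 1\<^sub>m 2" .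
  have x: "a * a = p * q" "a * p = 0" "a * q = 0"
    using arg_cong[OF xx, of "\<lambda>M. M $$ (0, 0)"] arg_cong[OF xx, of "\<lambda>M. M $$ (1, 0)"]
      arg_cong[OF xx, of "\<lambda>M. M $$ (0, 1)"]
    by (simp_all add: idx del: index_mult_mat(1))
  have y: "b * b = r * s" "b * r = 0" "b * s = 0"
    using arg_cong[OF yy, of "\<lambda>M. M $$ (0, 0)"] arg_cong[OF yy, of "\<lambda>M. M $$ (1, 0)"]
      arg_cong[OF yy, of "\<lambda>M. M $$ (0, 1)"]
    by (simp_all add: idx del: index_mult_mat(1))
  have a: "a = 0" using x by auto
  have b: "b = 0" using y by auto
  have "p * s + q * r = 1"
    using arg_cong[OF xy, of "\<lambda>M. M $$ (0, 0)"] c a b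
    by (simp add: idx del: index_mult_mat(1)) (simp add: algebra_simps neg_eq_iff_add_eq_0)
  with det have "p * s = 1" "q * r = 0" by (simp_all add: algebra_simps)
  with x y a b show "a = 0 \<and> b = 0 \<and> q = 0 \<and> r = 0" by auto
next
  note idx = index_mult_mat_2 base_matrix_carrier base_matrix_index
  assume z: "a = 0 \<and> b = 0 \<and> q = 0 \<and> r = 0"
  with det have ps: "p * s = 1" by simp
  define D where "D c = Matrix.mat 2 2 (\<lambda>(i, j). if i \<noteq> j then 0 else if i = 1 then c else 1)" for c :: complex
  have D: "D c \<in> carrier_mat 2 2" "D c $$ (0, 0) = 1" "D c $$ (0, Suc 0) = 0" "D c $$ (Suc 0, 0) = 0"
    "D c $$ (Suc 0, Suc 0) = c" for c by (simp_all add: D_def)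
  have inv: "D c * D d = 1\<^sub>m 2" if "c * d = 1" for c d
    using that
    by (subst eq_mat_2_iff)
      (auto simp: D index_mult_mat_2 simp del: index_mult_mat(1) intro!: mult_carrier_mat[of _ 2 2])
  have m: "D p * CM_X0 2 \<in> carrier_mat 2 2" "D p * CM_Y0 2 \<in> carrier_mat 2 2"
    by (auto intro!: mult_carrier_mat[of _ 2 2] D(1))
  have "base_matrix a p q = D p * CM_X0 2 * D s" "base_matrix b r s = D p * CM_Y0 2 * D s"
    using z m mult_carrier_mat[OF m(1) D(1)[of s]] mult_carrier_mat[OF m(2) D(1)[of s]]
    by (simp_all add: eq_mat_2_iff D idx base_pair_2 del: index_mult_mat(1))
  then have "similar_mat_wit (base_matrix a p q) (CM_X0 2) (D p) (D s)"
    "similar_mat_wit (base_matrix b r s) (CM_Y0 2) (D p) (D s)"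
    using inv[OF ps] inv[of s p] ps D(1) base_matrix_carrier
    by (auto intro!: similar_mat_witI[of _ _ 2] mult_carrier_mat[of _ 2 2] simp: base_pair_2 mult.commute)
  then show "(base_pair 2, (base_matrix a p q, base_matrix b r s)) \<in> CM_rel 2"
    using v base_pair_CM_pairs[of 2] by (auto simp: CM_rel_def)
qed

lemma affine_map_G_stab_2_iff:
  assumes "p * s - q * r = 1"
  shows "affine_map a p q b r s \<in> G_stab 2 \<longleftrightarrow> a = 0 \<and> b = 0 \<and> q = 0 \<and> r = 0"
proof -
  note G = affine_map_in_Aut_comm[OF assms, of a b]
  have "image_pair 2 (base_pair 2) (affine_map a p q b r s) = (base_matrix a p q, base_matrix b r s)"
    by (simp add: image_pair_def affine_map_gens subst_mat_affine_2)
  then show ?thesis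
    using G image_pair_CM_pairs[OF G base_pair_CM_pairs, of 2]
    by (simp add: G_stab_iff conj_base_pair_2_iff[OF assms])
qed

lemma holomorphic_subst_mat:
  assumes "entire_family P" "v \<in> pair_carrier n" "i < n" "j < n"
  shows "(\<lambda>t. subst_mat n v (P t) $$ (i, j)) holomorphic_on UNIV"
  using assms(1)
proof (induction rule: entire_family.induct)
  case (single f w)
  then show ?case
    using word_eval_carrier[OF assms(2), of "letters w"] assms(3,4)
    by (auto simp: subst_mat_single[OF assms(2)] intro!: holomorphic_intros)
next
  case (add P Q)
  then show ?case
    using subst_mat_carrier[of n v] assms(3,4)
    by (simp add: subst_mat_add index_add_mat(1)[of _ "subst_mat n v _"] carrier_matD[OF subst_mat_carrier])
      (auto intro: holomorphic_intros)
qed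

section \<open>Connectedness\<close>

text \<open>Scaling the translation part by \<open>t\<close> and moving the linear part along the path in \<open>SL\<^sub>2\<close> preserves the
  conditions that cut out the stabilizer among the affine maps: no condition for \<open>n = 0\<close>, no
  translation part for \<open>n = 1\<close>, and no translation part and a diagonal linear part for \<open>n = 2\<close>.\<close>

lemma affine_map_curve_connected:
  assumes n: "n \<in> {0, 1, 2}" and det: "p * s - q * r = 1"
    and mem: "affine_map a p q b r s \<in> G_stab n"
  shows "curve_connected (G_stab n) (affine_map a p q b r s)"
proof -
  obtain P Q R S where hol: "P holomorphic_on UNIV" "Q holomorphic_on UNIV" "R holomorphic_on UNIV"
      "S holomorphic_on UNIV"
    and d: "\<And>t. P t * S t - Q t * R t = 1"
    and v: "P 0 = 1" "Q 0 = 0" "R 0 = 0" "S 0 = 1" "P 1 = p" "Q 1 = q" "R 1 = r" "S 1 = s"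
    and diag: "\<And>t. q = 0 \<Longrightarrow> r = 0 \<Longrightarrow> Q t = 0 \<and> R t = 0"
    by (rule SL2_entire_path[OF det]) (rule that; assumption)
  define \<gamma> where "\<gamma> t = affine_map (t * a) (P t) (Q t) (t * b) (R t) (S t)" for t
  have G: "\<gamma> t \<in> carrier Aut_comm" for t
    unfolding \<gamma>_def by (rule affine_map_in_Aut_comm[OF d])
  have "\<gamma> t \<in> G_stab n" for t
  proof -
    consider "n = 0" | "n = 1" | "n = 2" using n by blast
    then show ?thesis
    proof cases
      case 1
      then show ?thesis using G by (simp add: G_stab_def)
    next
      case 2
      then have "a = 0" "b = 0" using mem by (simp_all add: G_stab_1_iff[simplified] affine_map_gens lookup_affine)
      then show ?thesis
        using 2 G[of t] by (simp add: G_stab_1_iff[simplified] \<gamma>_def affine_map_gens lookup_affine)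
    next
      case 3
      then have "a = 0" "b = 0" "q = 0" "r = 0" using mem by (simp_all add: affine_map_G_stab_2_iff[OF det])
      then show ?thesis
        unfolding \<gamma>_def 3 affine_map_G_stab_2_iff[OF d] using diag[of t] by simp
    qed
  qed
  moreover have "entire_curve \<gamma>"
    unfolding \<gamma>_def by (intro entire_curve_affine_map hol holomorphic_intros)
  ultimately show ?thesis
    unfolding curve_connected_def
    by (intro exI[of _ \<gamma>]) (auto simp: \<gamma>_def v affine_map_id)
qed

text \<open>Composing the contraction with the inverse of an affine map that depends holomorphically on \<open>t\<close>
  keeps it in the stabilizer. The right inverse \<open>\<beta>\<close> in the hypothesis \<open>stab\<close> stands for the inverse of the
  correction. As the correction agrees with the contraction at \<open>t = 0\<close>, the corrected curve starts
  at the identity, and it ends at \<open>\<sigma>\<close> up to an affine element of the stabilizer.\<close>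

lemma affine_correction_curve_connected:
  assumes n: "n \<in> {0, 1, 2}" and \<sigma>: "\<sigma> \<in> G_stab n"
    and hol: "a holomorphic_on UNIV" "p holomorphic_on UNIV" "q holomorphic_on UNIV"
      "b holomorphic_on UNIV" "r holomorphic_on UNIV" "s holomorphic_on UNIV"
    and det: "\<And>t. p t * s t - q t * r t = 1"
    and start: "contraction \<sigma> 0 = affine_map (a 0) (p 0) (q 0) (b 0) (r 0) (s 0)"
    and stab: "\<And>t \<beta>. \<beta> \<in> carrier Aut_comm \<Longrightarrow> affine_map (a t) (p t) (q t) (b t) (r t) (s t) \<circ> \<beta> = id \<Longrightarrow>
       contraction \<sigma> t \<circ> \<beta> \<in> G_stab n"
  shows "curve_connected (G_stab n) \<sigma>"
proof -
  interpret group Aut_comm by (rule group_Aut_comm)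
  define A where "A t = affine_map (a t) (p t) (q t) (b t) (r t) (s t)" for t
  define B where "B t = affine_map (q t * b t - s t * a t) (s t) (- q t)
     (r t * a t - p t * b t) (- r t) (p t)" for t
  have AB: "A t \<circ> B t = id" "B t \<circ> A t = id" for t
    unfolding A_def B_def by (rule affine_map_inverse[OF det])+
  have "s t * p t - (- q t) * (- r t) = 1" for t using det[of t] by (simp add: mult.commute)
  then have BG: "B t \<in> carrier Aut_comm" for t unfolding B_def by (rule affine_map_in_Aut_comm)
  have AG: "A t \<in> carrier Aut_comm" for t unfolding A_def by (rule affine_map_in_Aut_comm[OF det])
  define \<gamma> where "\<gamma> t = contraction \<sigma> t \<circ> B t" for t
  have "alg_hom \<sigma>"
    using subgroup.mem_carrier[OF subgroup_G_stab \<sigma>] by (simp add: carrier_Aut_comm_iff)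
  then have \<gamma>1: "\<gamma> 1 = \<sigma> \<circ> B 1" by (simp add: \<gamma>_def contraction_1)
  have \<gamma>S: "\<gamma> t \<in> G_stab n" for t
    unfolding \<gamma>_def using stab[OF BG] AB(1) by (simp add: A_def)
  have "entire_curve B"
    unfolding B_def by (intro entire_curve_affine_map hol holomorphic_intros)
  then have "entire_curve \<gamma>"
    unfolding \<gamma>_def by (rule entire_curve_comp[OF entire_curve_contraction])
  moreover have "\<gamma> 0 = id" by (simp add: \<gamma>_def start AB(1) flip: A_def)
  ultimately have c: "curve_connected (G_stab n) (\<gamma> 1)"
    using \<gamma>S unfolding curve_connected_def by blast
  have "inv\<^bsub>Aut_comm\<^esub> (\<gamma> 1) \<otimes>\<^bsub>Aut_comm\<^esub> \<sigma> \<in> G_stab n"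
    by (intro subgroup.m_closed[OF subgroup_G_stab] subgroup.m_inv_closed[OF subgroup_G_stab] \<gamma>S \<sigma>)
  moreover have \<sigma>': "\<sigma> = \<gamma> 1 \<circ> A 1" by (simp add: \<gamma>1 AB comp_assoc)
  have "\<sigma> = \<gamma> 1 \<otimes>\<^bsub>Aut_comm\<^esub> A 1" unfolding Aut_comm_simps(1) by (rule \<sigma>')
  from iffD2[OF inv_solve_left[OF AG subgroup.mem_carrier[OF subgroup_G_stab \<gamma>S]
        subgroup.mem_carrier[OF subgroup_G_stab \<sigma>]] this]
  have "inv\<^bsub>Aut_comm\<^esub> (\<gamma> 1) \<otimes>\<^bsub>Aut_comm\<^esub> \<sigma> = A 1" by (rule sym)
  ultimately have "A 1 \<in> G_stab n" by simp
  then have "curve_connected (G_stab n) (A 1)"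
    unfolding A_def by (rule affine_map_curve_connected[OF n det])
  then show ?thesis
    using curve_connected_comp[OF subgroup_G_stab c] \<sigma>' by simp
qed

lemma lookup_contract_0: "Poly_Mapping.lookup (contract t p) 0 = Poly_Mapping.lookup p 0"
  by (induction p rule: free_alg_single_induct)
    (auto simp: contract_add contract_single lookup_add lookup_single zero_nc_word_def when_def)

text \<open>For \<open>n \<le> 1\<close> the contraction stays in the stabilizer and the correction is the constant \<open>\<sigma>\<^sub>0\<close>. For
  \<open>n = 2\<close> the correction is the affine map with the same effect on the base point.\<close>

lemma G_stab_curve_connected:
  assumes n: "n \<in> {0, 1, 2}" and \<sigma>: "\<sigma> \<in> G_stab n"
  shows "curve_connected (G_stab n) \<sigma>"
proof (cases "n = 2")
  interpret group Aut_comm by (rule group_Aut_comm)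
  case False
  have G: "\<sigma> \<in> carrier Aut_comm" using subgroup.subset[OF subgroup_G_stab] \<sigma> by blast
  have C: "contraction \<sigma> t \<in> G_stab n" for t
    using n False \<sigma> contraction_in_Aut_comm[OF G, of t]
    by (auto simp: G_stab_1_iff[simplified] G_stab_def[of 0] contraction_def subst_alg_gens lookup_contract_0)
  show ?thesis
  proof (rule affine_correction_curve_connected[OF n \<sigma> _ _ _ _ _ _ affine_part_det[OF G] contraction_0])
    fix t \<beta>
    assume \<beta>: "\<beta> \<in> carrier Aut_comm" and "affine_map (Poly_Mapping.lookup (\<sigma> gen_x) 0)
          (Poly_Mapping.lookup (\<sigma> gen_x) (Word [Lx])) (Poly_Mapping.lookup (\<sigma> gen_x) (Word [Ly]))
          (Poly_Mapping.lookup (\<sigma> gen_y) 0) (Poly_Mapping.lookup (\<sigma> gen_y) (Word [Lx]))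
          (Poly_Mapping.lookup (\<sigma> gen_y) (Word [Ly])) \<circ> \<beta> = id"
    then have "contraction \<sigma> 0 \<circ> \<beta> = id" unfolding contraction_0 by blast
    then have "inv\<^bsub>Aut_comm\<^esub> (contraction \<sigma> 0) = \<beta>"
      using \<beta> contraction_in_Aut_comm[OF G, of 0]
      by (metis Aut_comm_simps inv_equality inv_inv inv_closed)
    then have "\<beta> \<in> G_stab n" using subgroup.m_inv_closed[OF subgroup_G_stab C] by blast
    then show "contraction \<sigma> t \<circ> \<beta> \<in> G_stab n"
      using subgroup.m_closed[OF subgroup_G_stab C] by (simp add: Aut_comm_simps)
  qed simp_all
next
  case True
  note [simp] = True
  have G: "\<sigma> \<in> carrier Aut_comm" using subgroup.subset[OF subgroup_G_stab] \<sigma> by blast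
  define X where "X t = subst_mat 2 (base_pair 2) (contraction \<sigma> t gen_x)" for t
  define Y where "Y t = subst_mat 2 (base_pair 2) (contraction \<sigma> t gen_y)" for t
  note aff = image_pair_2_affine[OF contraction_in_Aut_comm[OF G] X_def Y_def]
  have hol: "(\<lambda>t. X t $$ (i, j)) holomorphic_on UNIV" "(\<lambda>t. Y t $$ (i, j)) holomorphic_on UNIV"
    if "i < 2" "j < 2" for i j
    unfolding X_def Y_def using entire_curve_contraction[of \<sigma>] that
    by (auto simp: entire_curve_def intro!: holomorphic_subst_mat base_pair_carrier)
  let ?A = "\<lambda>t. affine_map (X t $$ (0, 0)) (X t $$ (1, 0)) (- X t $$ (0, 1))
      (Y t $$ (0, 0)) (Y t $$ (1, 0)) (- Y t $$ (0, 1))"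
  show ?thesis
  proof (rule affine_correction_curve_connected[OF n \<sigma> _ _ _ _ _ _ aff(3)])
    show "contraction \<sigma> 0 = ?A 0"
      by (simp add: X_def Y_def contraction_0 affine_map_gens subst_mat_affine_2 base_matrix_index)
  next
    fix t \<beta>
    assume \<beta>: "\<beta> \<in> carrier Aut_comm" and id: "?A t \<circ> \<beta> = id"
    have "image_pair 2 (base_pair 2) (?A t) = image_pair 2 (base_pair 2) (contraction \<sigma> t)"
      unfolding image_pair_def affine_map_gens subst_mat_affine_2
      using aff(1,2)[of t, symmetric] by (simp add: X_def Y_def)
    then have "image_pair 2 (base_pair 2) (contraction \<sigma> t \<circ> \<beta>) = image_pair 2 (base_pair 2) (?A t \<circ> \<beta>)"
      using contraction_in_Aut_comm[OF G, of t]
      by (simp add: image_pair_comp base_pair_carrier alg_hom_affine_map carrier_Aut_comm_iff)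
    also have "\<dots> = base_pair 2" unfolding id by (rule image_pair_id[OF base_pair_carrier])
    finally have "image_pair 2 (base_pair 2) (contraction \<sigma> t \<circ> \<beta>) = base_pair 2" .
    moreover have "contraction \<sigma> t \<circ> \<beta> \<in> carrier Aut_comm"
      using monoid.m_closed[OF group.is_monoid[OF group_Aut_comm] contraction_in_Aut_comm[OF G] \<beta>]
      by (simp add: Aut_comm_simps)
    moreover have "(base_pair 2, base_pair 2) \<in> CM_rel 2"
      using equiv_CM_rel base_pair_CM_pairs[of 2] by (metis equiv_class_eq_iff one_le_numeral)
    ultimately show "contraction \<sigma> t \<circ> \<beta> \<in> G_stab n"
      by (simp add: G_stab_iff)
  qed (auto intro!: holomorphic_intros hol)
qed

theorem proposition7:
  fixes n :: nat
  assumes "n \<in> {0, 1, 2}"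
  shows "connected_space (subtopology ind_zariski (G_stab n)) \<and>
         irreducible_space (subtopology ind_zariski (G_stab n))"
proof -
  have "irreducible_space (subtopology ind_zariski (G_stab n))"
    by (intro irreducible_if_curve_connected subgroup_G_stab G_stab_curve_connected assms)
  then show ?thesis using connected_if_irreducible by blast
qed

end
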